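(* A $\mathcal J$-non-negative vector field $X$ on a forward invariant region $U$ has a linear Poincaré flow which is (strictly) $\mathcal J$-monotone if, and only if, the operator $$\hat J_x:=DX(x)^*\cdot\Pi_x^*J\,\Pi_x+\Pi_x^*J\,\Pi_x\cdot DX(x)$$ is a (positive) non-negative self-adjoint operator, that is, all its eigenvalues are (positive) non-negative, for each $x\in U$ such that $X(x)\neq 0$. (The words in parentheses correspond to each other: strictly monotone corresponds to positive, monotone to non-negative.)
   Context: $M$ is a connected compact Riemannian manifold of dimension $n\ge3$; $X$ is a $C^1$ vector field on $M$ with flow $X_t$ and derivative cocycle $DX_t$; $U$ is forward invariant: $X_t(U)\subset U$ for $t>0$. $\mathcal J$ is a field of non-degenerate quadratic forms with constant index on $U$: a continuous family of non-degenerate quadratic forms $\mathcal J_x:T_xM\to\mathbb R$, $x\in U$, continuously differentiable along the flow, whose index $q$, $0<q<n$, is the maximal dimension of subspaces of non-positive vectors. $X$ is $\mathcal J$-non-negative on $U$ if $\mathcal J_x(X(x))\ge0$ for all $x\in U$. Adapted inner product: near each point one chooses a basis $v_1,\dots,v_n$ of the tangent spaces in which $\mathcal J(\sum\alpha_iv_i)=-\sum_{i\le q}\alpha_i^2+\sum_{j>q}\alpha_j^2$; the adapted inner product $\langle\cdot,\cdot\rangle$ makes this basis orthonormal, and $J$ is the self-adjoint operator with $\mathcal J(v)=\langle Jv,v\rangle$, i.e. $J=\mathrm{diag}(-1,\dots,-1,1,\dots,1)$ in the adapted basis. The derivative cocycle, and hence $DX(x)$, is written in these adapted coordinates; $*$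 denotes the adjoint with respect to the adapted inner product. Linear Poincaré flow: since $X$ is assumed $\mathcal J$-non-negative, the span $E^X_x$ of $X(x)\neq0$ is regarded as a $\mathcal J$-non-degenerate subspace, so that $T_xM=E^X_x\oplus N_x$, where $N_x=\{v\in T_xM:\langle Jv,X(x)\rangle=0\}$ is the pseudo-orthogonal complement of $E^X_x$ with respect to the bilinear form of $\mathcal J$. $\Pi_x:T_xM\to N_x$ is the projection on $N_x$ parallel to $X(x)$, and $P^tv:=\Pi_{X_t(x)}DX_tv$ for $v\in T_xM$, $t\in\mathbb R$, $X(x)\ne0$. The linear Poincaré flow $P^t$ is $\mathcal J$-monotone if $\partial_t\mathcal J(P^tv)|_{t=0}\ge0$ for each $x\in U$ and $v\in T_xM\setminus\{0\}$, and strictly $\mathcal J$-monotone if $\partial_t\mathcal J(P^tv)|_{t=0}>0$ for each $x\in U$ and $v\in T_xM\setminus\{0\}$, where $x$ ranges over the regular points ($X(x)\neq0$), on which $P^t$ is defined.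
   Formalization: The adapted bases are required to contain a vector spanning the direction of X near each regular point of U (such bases are proved to exist); for an arbitrary adapted basis that rotates along the flow, the operator can fail to be non-negative although the linear Poincaré flow is monotone. *)

theory Defs
  imports "HOL-Analysis.Analysis" "HOL-Library.Function_Algebras"
begin

instantiation "fun" :: (type, real_vector) real_vector
begin

definition scaleR_fun :: "real \<Rightarrow> ('a \<Rightarrow> 'b) \<Rightarrow> 'a \<Rightarrow> 'b"
  where "scaleR_fun a f = (\<lambda>x. a *\<^sub>R f x)"

instance
  by standard (simp_all add: scaleR_fun_def fun_eq_iff scaleR_add_right scaleR_add_left)

end


section \<open>Smooth manifolds and tangent vectors\<close>

text \<open>The manifold is a Hausdorff type, with an atlas of charts \<open>(domain, map)\<close> into \<open>\<real>\<^sup>n\<close>,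
  \<open>n = CARD('n)\<close>. A chart map is only meaningful on the domain of the chart.\<close>

type_synonym ('m, 'n) chart = "'m set \<times> ('m \<Rightarrow> real^'n)"

primrec Ck_on :: "nat \<Rightarrow> 'a::euclidean_space set \<Rightarrow> ('a \<Rightarrow> 'b::real_normed_vector) \<Rightarrow> bool" where
  "Ck_on 0 S f \<longleftrightarrow> continuous_on S f"
| "Ck_on (Suc k) S f \<longleftrightarrow>
     (\<exists>f'. (\<forall>u\<in>S. (f has_derivative f' u) (at u)) \<and> (\<forall>w. Ck_on k S (\<lambda>u. f' u w)))"

definition chart_inv :: "('m, 'n::finite) chart \<Rightarrow> real^'n \<Rightarrow> 'm"
  where "chart_inv c = inv_into (fst c) (snd c)"

definition transition :: "('m, 'n::finite) chart \<Rightarrow> ('m, 'n) chart \<Rightarrow> real^'n \<Rightarrow> real^'n"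
  where "transition c d = snd d \<circ> chart_inv c"

definition smooth_atlas :: "('m::t2_space, 'n::finite) chart set \<Rightarrow> bool" where
  "smooth_atlas A \<longleftrightarrow>
     (\<forall>c\<in>A. open (fst c) \<and> open (snd c ` fst c) \<and>
        homeomorphism (fst c) (snd c ` fst c) (snd c) (chart_inv c)) \<and>
     (\<Union>c\<in>A. fst c) = UNIV \<and>
     (\<forall>c\<in>A. \<forall>d\<in>A. \<forall>k. Ck_on k (snd c ` (fst c \<inter> fst d)) (transition c d))"

text \<open>A tangent vector at \<open>x\<close> is the family of its coordinate vectors in all charts around \<open>x\<close>,
  which transform by the derivatives of the chart changes (and, so that the family determines the
  vector, are \<open>0\<close> at all other indices). The vector space operations are pointwise.\<close>

type_synonym ('m, 'n) tangent = "('m, 'n) chart \<Rightarrow> real^'n"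

definition tangent_space ::
  "('m::t2_space, 'n::finite) chart set \<Rightarrow> 'm \<Rightarrow> ('m, 'n) tangent set" where
  "tangent_space A x =
     {v. (\<forall>c. c \<notin> A \<or> x \<notin> fst c \<longrightarrow> v c = 0) \<and>
         (\<forall>c\<in>A. \<forall>d\<in>A. x \<in> fst c \<and> x \<in> fst d \<longrightarrow>
            v d = frechet_derivative (transition c d) (at (snd c x)) (v c))}"

text \<open>The tangent vector at \<open>x\<close> whose coordinate vector in the chart \<open>c\<close> is \<open>w\<close>.\<close>

definition tvec ::
  "('m::t2_space, 'n::finite) chart set \<Rightarrow> ('m, 'n) chart \<Rightarrow> 'm \<Rightarrow> real^'n \<Rightarrow> ('m, 'n) tangent" where
  "tvec A c x w = (\<lambda>d. if d \<in> A \<and> x \<in> fst d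
     then frechet_derivative (transition c d) (at (snd c x)) w else 0)"


section \<open>Quadratic forms on tangent spaces\<close>

definition sym_bilinear_on :: "'v::real_vector set \<Rightarrow> ('v \<Rightarrow> 'v \<Rightarrow> real) \<Rightarrow> bool" where
  "sym_bilinear_on S B \<longleftrightarrow>
     (\<forall>u\<in>S. \<forall>v\<in>S. B u v = B v u) \<and>
     (\<forall>u\<in>S. \<forall>v\<in>S. \<forall>w\<in>S. B (u + v) w = B u w + B v w) \<and>
     (\<forall>a. \<forall>u\<in>S. \<forall>v\<in>S. B (a *\<^sub>R u) v = a * B u v)"

definition quadratic_form_on :: "'v::real_vector set \<Rightarrow> ('v \<Rightarrow> real) \<Rightarrow> bool" where
  "quadratic_form_on S Q \<longleftrightarrow> (\<exists>B. sym_bilinear_on S B \<and> (\<forall>v\<in>S. Q v = B v v))"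

definition polar :: "('v::real_vector \<Rightarrow> real) \<Rightarrow> 'v \<Rightarrow> 'v \<Rightarrow> real"
  where "polar Q u v = (Q (u + v) - Q u - Q v) / 2"

definition nondegenerate_on :: "'v::real_vector set \<Rightarrow> ('v \<Rightarrow> real) \<Rightarrow> bool" where
  "nondegenerate_on S Q \<longleftrightarrow> (\<forall>v\<in>S. (\<forall>w\<in>S. polar Q v w = 0) \<longrightarrow> v = 0)"

definition has_index_on :: "'v::real_vector set \<Rightarrow> ('v \<Rightarrow> real) \<Rightarrow> nat \<Rightarrow> bool" where
  "has_index_on S Q q \<longleftrightarrow>
     (\<exists>V. subspace V \<and> V \<subseteq> S \<and> (\<forall>v\<in>V. Q v \<le> 0) \<and> dim V = q) \<and>
     (\<forall>V. subspace V \<and> V \<subseteq> S \<and> (\<forall>v\<in>V. Q v \<le> 0) \<longrightarrow> dim V \<le> q)"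

definition riemannian_metric ::
  "('m::t2_space, 'n::finite) chart set \<Rightarrow>
   ('m \<Rightarrow> ('m, 'n) tangent \<Rightarrow> ('m, 'n) tangent \<Rightarrow> real) \<Rightarrow> bool" where
  "riemannian_metric A g \<longleftrightarrow>
     (\<forall>x. sym_bilinear_on (tangent_space A x) (g x) \<and>
        (\<forall>v\<in>tangent_space A x. v \<noteq> 0 \<longrightarrow> 0 < g x v v)) \<and>
     (\<forall>c\<in>A. \<forall>v w k. Ck_on k (snd c ` fst c)
        (\<lambda>u. g (chart_inv c u) (tvec A c (chart_inv c u) v) (tvec A c (chart_inv c u) w)))"


section \<open>Vector fields, flows and the derivative cocycle\<close>

definition C1_vector_field ::
  "('m::t2_space, 'n::finite) chart set \<Rightarrow> ('m \<Rightarrow> ('m, 'n) tangent) \<Rightarrow> bool" where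
  "C1_vector_field A X \<longleftrightarrow>
     (\<forall>x. X x \<in> tangent_space A x) \<and>
     (\<forall>c\<in>A. Ck_on 1 (snd c ` fst c) (\<lambda>u. X (chart_inv c u) c))"

definition flow_of ::
  "('m::t2_space, 'n::finite) chart set \<Rightarrow> ('m \<Rightarrow> ('m, 'n) tangent) \<Rightarrow>
   (real \<Rightarrow> 'm \<Rightarrow> 'm) \<Rightarrow> bool" where
  "flow_of A X Xt \<longleftrightarrow>
     continuous_on UNIV (\<lambda>(t, x). Xt t x) \<and>
     (\<forall>x. Xt 0 x = x) \<and> (\<forall>s t x. Xt (s + t) x = Xt s (Xt t x)) \<and>
     (\<forall>t x. \<forall>c\<in>A. Xt t x \<in> fst c \<longrightarrow>
        ((\<lambda>s. snd c (Xt s x)) has_vector_derivative X (Xt t x) c) (at t))"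

text \<open>\<open>DX t x\<close> is the tangent map \<open>T\<^sub>x M \<rightarrow> T\<^sub>y M\<close>, \<open>y = X\<^sub>t x\<close>, of the diffeomorphism \<open>X\<^sub>t\<close>.\<close>

definition derivative_cocycle ::
  "('m::t2_space, 'n::finite) chart set \<Rightarrow> (real \<Rightarrow> 'm \<Rightarrow> 'm) \<Rightarrow>
   (real \<Rightarrow> 'm \<Rightarrow> ('m, 'n) tangent \<Rightarrow> ('m, 'n) tangent) \<Rightarrow> bool" where
  "derivative_cocycle A Xt DX \<longleftrightarrow>
     (\<forall>t x. \<forall>v\<in>tangent_space A x. DX t x v \<in> tangent_space A (Xt t x)) \<and>
     (\<forall>t x. \<forall>c\<in>A. \<forall>d\<in>A. x \<in> fst c \<and> Xt t x \<in> fst d \<longrightarrow>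
        ((\<lambda>u. snd d (Xt t (chart_inv c u))) has_derivative
          (\<lambda>w. DX t x (tvec A c x w) d)) (at (snd c x)))"

text \<open>For a quantity that is only defined on a set \<open>S\<close>, the derivative along an orbit is taken
  within the times at which the orbit lies in \<open>S\<close>. On an open set this is the ordinary two-sided
  derivative.\<close>

definition C1_along_flow_on ::
  "(real \<Rightarrow> 'm \<Rightarrow> 'm) \<Rightarrow> 'm set \<Rightarrow> ('m \<Rightarrow> 'b::real_normed_vector) \<Rightarrow> bool" where
  "C1_along_flow_on Xt S f \<longleftrightarrow>
     (\<forall>x\<in>S. \<exists>f'. continuous_on {t. Xt t x \<in> S} f' \<and>
        (\<forall>t. Xt t x \<in> S \<longrightarrow>
           ((\<lambda>s. f (Xt s x)) has_vector_derivative f' t) (at t within {s. Xt s x \<in> S})))"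

definition nondegenerate_field ::
  "('m::t2_space, 'n::finite) chart set \<Rightarrow> (real \<Rightarrow> 'm \<Rightarrow> 'm) \<Rightarrow> 'm set \<Rightarrow>
   ('m \<Rightarrow> ('m, 'n) tangent \<Rightarrow> real) \<Rightarrow> nat \<Rightarrow> bool" where
  "nondegenerate_field A Xt U J q \<longleftrightarrow>
     (\<forall>x\<in>U. quadratic_form_on (tangent_space A x) (J x) \<and>
        nondegenerate_on (tangent_space A x) (J x) \<and>
        has_index_on (tangent_space A x) (J x) q) \<and>
     (\<forall>c\<in>A. \<forall>w. continuous_on (U \<inter> fst c) (\<lambda>x. J x (tvec A c x w)) \<and>
        C1_along_flow_on Xt (U \<inter> fst c) (\<lambda>x. J x (tvec A c x w)))"


section \<open>The linear Poincare flow\<close>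

definition normal_space ::
  "('m::t2_space, 'n::finite) chart set \<Rightarrow> ('m \<Rightarrow> ('m, 'n) tangent) \<Rightarrow>
   ('m \<Rightarrow> ('m, 'n) tangent \<Rightarrow> real) \<Rightarrow> 'm \<Rightarrow> ('m, 'n) tangent set" where
  "normal_space A X J x = {v \<in> tangent_space A x. polar (J x) v (X x) = 0}"

definition normal_proj ::
  "('m::t2_space, 'n::finite) chart set \<Rightarrow> ('m \<Rightarrow> ('m, 'n) tangent) \<Rightarrow>
   ('m \<Rightarrow> ('m, 'n) tangent \<Rightarrow> real) \<Rightarrow> 'm \<Rightarrow> ('m, 'n) tangent \<Rightarrow> ('m, 'n) tangent" where
  "normal_proj A X J x v = (THE w. w \<in> normal_space A X J x \<and> v - w \<in> span {X x})"

definition poincare_flow ::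
  "('m::t2_space, 'n::finite) chart set \<Rightarrow> ('m \<Rightarrow> ('m, 'n) tangent) \<Rightarrow> (real \<Rightarrow> 'm \<Rightarrow> 'm) \<Rightarrow>
   (real \<Rightarrow> 'm \<Rightarrow> ('m, 'n) tangent \<Rightarrow> ('m, 'n) tangent) \<Rightarrow> ('m \<Rightarrow> ('m, 'n) tangent \<Rightarrow> real) \<Rightarrow>
   real \<Rightarrow> 'm \<Rightarrow> ('m, 'n) tangent \<Rightarrow> ('m, 'n) tangent" where
  "poincare_flow A X Xt DX J t x v = normal_proj A X J (Xt t x) (DX t x v)"

definition poincare_monotone ::
  "('m::t2_space, 'n::finite) chart set \<Rightarrow> ('m \<Rightarrow> ('m, 'n) tangent) \<Rightarrow> (real \<Rightarrow> 'm \<Rightarrow> 'm) \<Rightarrow>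
   (real \<Rightarrow> 'm \<Rightarrow> ('m, 'n) tangent \<Rightarrow> ('m, 'n) tangent) \<Rightarrow> ('m \<Rightarrow> ('m, 'n) tangent \<Rightarrow> real) \<Rightarrow>
   'm set \<Rightarrow> bool" where
  "poincare_monotone A X Xt DX J U \<longleftrightarrow>
     (\<forall>x\<in>U. X x \<noteq> 0 \<longrightarrow> (\<forall>v\<in>tangent_space A x - {0}.
        \<exists>D\<ge>0. ((\<lambda>t. J (Xt t x) (poincare_flow A X Xt DX J t x v)) has_real_derivative D)
               (at 0 within {t. Xt t x \<in> U})))"

definition poincare_strictly_monotone ::
  "('m::t2_space, 'n::finite) chart set \<Rightarrow> ('m \<Rightarrow> ('m, 'n) tangent) \<Rightarrow> (real \<Rightarrow> 'm \<Rightarrow> 'm) \<Rightarrow>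
   (real \<Rightarrow> 'm \<Rightarrow> ('m, 'n) tangent \<Rightarrow> ('m, 'n) tangent) \<Rightarrow> ('m \<Rightarrow> ('m, 'n) tangent \<Rightarrow> real) \<Rightarrow>
   'm set \<Rightarrow> bool" where
  "poincare_strictly_monotone A X Xt DX J U \<longleftrightarrow>
     (\<forall>x\<in>U. X x \<noteq> 0 \<longrightarrow> (\<forall>v\<in>tangent_space A x - {0}.
        \<exists>D>0. ((\<lambda>t. J (Xt t x) (poincare_flow A X Xt DX J t x v)) has_real_derivative D)
               (at 0 within {t. Xt t x \<in> U})))"


section \<open>Adapted coordinates\<close>

text \<open>A local frame is a family \<open>e i\<close> of vector fields. The index set \<open>I\<close>, of cardinality \<open>q\<close>,
  plays the role of \<open>{1, \<dots>, q}\<close>.\<close>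

definition frame_comb ::
  "('n::finite \<Rightarrow> 'm \<Rightarrow> ('m, 'n) tangent) \<Rightarrow> 'm \<Rightarrow> real^'n \<Rightarrow> ('m, 'n) tangent"
  where "frame_comb e x \<alpha> = (\<Sum>i\<in>UNIV. (\<alpha> $ i) *\<^sub>R e i x)"

definition frame_coords ::
  "('n::finite \<Rightarrow> 'm \<Rightarrow> ('m, 'n) tangent) \<Rightarrow> 'm \<Rightarrow> ('m, 'n) tangent \<Rightarrow> real^'n"
  where "frame_coords e x v = (THE \<alpha>. frame_comb e x \<alpha> = v)"

definition adapted_frame_near ::
  "('m::t2_space, 'n::finite) chart set \<Rightarrow> (real \<Rightarrow> 'm \<Rightarrow> 'm) \<Rightarrow> ('m \<Rightarrow> ('m, 'n) tangent \<Rightarrow> real) \<Rightarrow>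
   'm set \<Rightarrow> 'n set \<Rightarrow> 'm \<Rightarrow> ('n \<Rightarrow> 'm \<Rightarrow> ('m, 'n) tangent) \<Rightarrow> bool" where
  "adapted_frame_near A Xt J U I p e \<longleftrightarrow> (\<exists>W. open W \<and> p \<in> W \<and>
     (\<forall>y\<in>W \<inter> U. inj (\<lambda>i. e i y) \<and> independent (range (\<lambda>i. e i y)) \<and>
        span (range (\<lambda>i. e i y)) = tangent_space A y \<and>
        (\<forall>\<alpha>. J y (frame_comb e y \<alpha>) = - (\<Sum>i\<in>I. (\<alpha> $ i)\<^sup>2) + (\<Sum>i\<in>-I. (\<alpha> $ i)\<^sup>2))) \<and>
     (\<forall>i. \<forall>c\<in>A. continuous_on (W \<inter> U \<inter> fst c) (\<lambda>y. e i y c) \<and>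
        C1_along_flow_on Xt (W \<inter> U \<inter> fst c) (\<lambda>y. e i y c)))"

text \<open>\<open>E p\<close> is the frame chosen near the regular point \<open>p \<in> U\<close>.\<close>

definition adapted_frames ::
  "('m::t2_space, 'n::finite) chart set \<Rightarrow> ('m \<Rightarrow> ('m, 'n) tangent) \<Rightarrow> (real \<Rightarrow> 'm \<Rightarrow> 'm) \<Rightarrow>
   ('m \<Rightarrow> ('m, 'n) tangent \<Rightarrow> real) \<Rightarrow> 'm set \<Rightarrow> 'n set \<Rightarrow>
   ('m \<Rightarrow> 'n \<Rightarrow> 'm \<Rightarrow> ('m, 'n) tangent) \<Rightarrow> bool" where
  "adapted_frames A X Xt J U I E \<longleftrightarrow>
     (\<forall>p\<in>U. X p \<noteq> 0 \<longrightarrow> adapted_frame_near A Xt J U I p (E p))"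

text \<open>The frames respect the splitting \<open>T M = E\<^sup>X \<oplus> N\<close>: one frame vector spans \<open>E\<^sup>X\<close>, and then the
  other ones, being pseudo-orthogonal to it, span \<open>N\<close>. This makes the matrix of the projection to
  \<open>N\<close> constant along orbits. It is needed because the matrix \<open>DX(x)\<close> below contains the derivative
  of the frame along the orbit: in an adapted frame that rotates \<open>X\<close> into \<open>N\<close>, the operator
  \<open>J_hat\<close> acquires mixed terms between \<open>E\<^sup>X\<close> and \<open>N\<close> and fails to be non-negative even if the linear
  Poincare flow is monotone.\<close>

definition respects_splitting ::
  "('m::t2_space \<Rightarrow> ('m, 'n::finite) tangent) \<Rightarrow> 'm set \<Rightarrow>
   ('m \<Rightarrow> 'n \<Rightarrow> 'm \<Rightarrow> ('m, 'n) tangent) \<Rightarrow> bool" where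
  "respects_splitting X U E \<longleftrightarrow>
     (\<forall>p\<in>U. X p \<noteq> 0 \<longrightarrow>
        (\<exists>W j. open W \<and> p \<in> W \<and> (\<forall>y\<in>W \<inter> U. E p j y \<in> span {X y})))"

text \<open>Operators written in adapted coordinates at \<open>x\<close>. As the frame is orthonormal for the adapted
  inner product, the adjoint with respect to it is the transposed matrix. \<open>DX(x)\<close> is the
  infinitesimal generator at \<open>x\<close> of the cocycle written in these coordinates.\<close>

definition J_mat :: "'n set \<Rightarrow> real^'n^'n"
  where "J_mat I = (\<chi> i j. if i = j then (if i \<in> I then -1 else 1) else 0)"

definition Pi_mat ::
  "('m::t2_space, 'n::finite) chart set \<Rightarrow> ('m \<Rightarrow> ('m, 'n) tangent) \<Rightarrow>
   ('m \<Rightarrow> ('m, 'n) tangent \<Rightarrow> real) \<Rightarrow> ('n \<Rightarrow> 'm \<Rightarrow> ('m, 'n) tangent) \<Rightarrow> 'm \<Rightarrow> real^'n^'n" where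
  "Pi_mat A X J e x = matrix (\<lambda>\<alpha>. frame_coords e x (normal_proj A X J x (frame_comb e x \<alpha>)))"

definition cocycle_mat ::
  "(real \<Rightarrow> 'm \<Rightarrow> 'm) \<Rightarrow> (real \<Rightarrow> 'm \<Rightarrow> ('m, 'n) tangent \<Rightarrow> ('m, 'n) tangent) \<Rightarrow>
   ('n::finite \<Rightarrow> 'm \<Rightarrow> ('m, 'n) tangent) \<Rightarrow> real \<Rightarrow> 'm \<Rightarrow> real^'n^'n" where
  "cocycle_mat Xt DX e t x =
     matrix (\<lambda>\<alpha>. frame_coords e (Xt t x) (DX t x (frame_comb e x \<alpha>)))"

definition DX_mat ::
  "(real \<Rightarrow> 'm \<Rightarrow> 'm) \<Rightarrow> (real \<Rightarrow> 'm \<Rightarrow> ('m, 'n) tangent \<Rightarrow> ('m, 'n) tangent) \<Rightarrow>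
   'm set \<Rightarrow> ('n::finite \<Rightarrow> 'm \<Rightarrow> ('m, 'n) tangent) \<Rightarrow> 'm \<Rightarrow> real^'n^'n" where
  "DX_mat Xt DX U e x =
     vector_derivative (\<lambda>t. cocycle_mat Xt DX e t x) (at 0 within {t. Xt t x \<in> U})"

definition J_hat ::
  "('m::t2_space, 'n::finite) chart set \<Rightarrow> ('m \<Rightarrow> ('m, 'n) tangent) \<Rightarrow> (real \<Rightarrow> 'm \<Rightarrow> 'm) \<Rightarrow>
   (real \<Rightarrow> 'm \<Rightarrow> ('m, 'n) tangent \<Rightarrow> ('m, 'n) tangent) \<Rightarrow> ('m \<Rightarrow> ('m, 'n) tangent \<Rightarrow> real) \<Rightarrow>
   'm set \<Rightarrow> 'n set \<Rightarrow> ('n \<Rightarrow> 'm \<Rightarrow> ('m, 'n) tangent) \<Rightarrow> 'm \<Rightarrow> real^'n^'n" where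
  "J_hat A X Xt DX J U I e x =
     (let D = DX_mat Xt DX U e x; P = Pi_mat A X J e x
      in transpose D ** (transpose P ** J_mat I ** P) + (transpose P ** J_mat I ** P) ** D)"

definition nonneg_selfadjoint :: "real^'n^'n \<Rightarrow> bool" where
  "nonneg_selfadjoint M \<longleftrightarrow> transpose M = M \<and>
     (\<forall>l v. v \<noteq> 0 \<and> M *v v = l *\<^sub>R v \<longrightarrow> 0 \<le> l)"

definition pos_selfadjoint :: "real^'n^'n \<Rightarrow> bool" where
  "pos_selfadjoint M \<longleftrightarrow> transpose M = M \<and>
     (\<forall>l v. v \<noteq> 0 \<and> M *v v = l *\<^sub>R v \<longrightarrow> 0 < l)"

end

theory Submission
  imports Defs
begin

text \<open>
  In a frame that respects the splitting, the projection to \<open>N\<close> just deletes one coordinate, hence has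
  the same matrix at all points of an orbit near \<open>x\<close>, and so has \<open>K = \<Pi>\<^sup>* J \<Pi>\<close>. If \<open>C(t)\<close> is the
  cocycle in frame coordinates, then \<open>\<J>(P\<^sup>t v) = \<langle>K C(t) \<alpha>, C(t) \<alpha>\<rangle>\<close> for the coordinates
  \<open>\<alpha>\<close> of \<open>v\<close>. Since \<open>C(0) = 1\<close> and \<open>C'(0) = DX(x)\<close>, the derivative at \<open>0\<close> is the quadratic form of
  the operator \<open>DX(x)\<^sup>* K + K DX(x)\<close>, whose sign is read off its eigenvalues.

  Two points need work: that \<open>C\<close> is differentiable at \<open>0\<close>, which rests on the first variation
  of the flow of a \<open>C\<^sup>1\<close> field, and that such frames exist, which is an indefinite Gram-Schmidt
  process starting with \<open>X / \<surd>\<J>(X)\<close>.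
\<close>

section \<open>Symmetric matrices and indefinite forms\<close>

text \<open>The set \<open>U\<close> is only forward invariant, not open, so every derivative at
  time 0 is taken within the times that an orbit spends in \<open>U\<close>. Forward invariance
  makes 0 a limit point of these times; the derivative is then unique, and this is what lets the
  sign of the quadratic form be recovered from monotonicity.

  The form and the frames are only continuous across orbits and \<open>C1\<close> along them, and
  \<open>X\<close> is only \<open>C1\<close>. The proof is shaped by this: a frame coordinate of a
  tangent vector is, up to sign, its pairing with a frame vector. The entries of the cocycle matrix
  thus become sums of products of functions of time that are separately differentiable at 0, and no
  frame has to be inverted.

  Tangent vectors are families indexed by charts, a space too large for dimension arguments, so
  linear algebra is done in \<open>real^'n\<close> through the isomorphism \<open>tvec\<close>. Of
  the spectral theory of symmetric matrices only the least eigenvalue, the minimum of the Rayleigh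
  quotient, is used.\<close>

lemma symmetric_matrix_least_eigenvalue:
  fixes M :: "real^'n^'n"
  assumes sym: "transpose M = M"
  obtains l v where "v \<noteq> 0" "M *v v = l *\<^sub>R v" "\<And>w. l * (w \<bullet> w) \<le> w \<bullet> (M *v w)"
proof -
  \<comment> \<open>On the unit sphere the Rayleigh quotient is the form itself, and compactness
    gives a minimiser \<open>v\<close>, which turns out to be the eigenvector.\<close>
  have "continuous_on (sphere 0 1) (\<lambda>v. v \<bullet> (M *v v))"
    by (intro continuous_intros linear_continuous_on linear_conv_bounded_linear[THEN iffD1]
        matrix_vector_mul_linear)
  moreover have "sphere (0::real^'n) 1 \<noteq> {}" by simp
  ultimately obtain v where v: "v \<in> sphere 0 1"
    and vmin: "\<And>w. w \<in> sphere 0 1 \<Longrightarrow> v \<bullet> (M *v v) \<le> w \<bullet> (M *v w)"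
    using continuous_attains_inf[of "sphere 0 1" "\<lambda>v. v \<bullet> (M *v v)"] by auto
  define l where "l = v \<bullet> (M *v v)"
  have vn: "norm v = 1" using v by simp
  then have vv: "v \<bullet> v = 1" by (simp add: dot_square_norm)
  have *: "l * (w \<bullet> w) \<le> w \<bullet> (M *v w)" for w
  proof (cases "w = 0")
    case False
    have "l \<le> (w /\<^sub>R norm w) \<bullet> (M *v (w /\<^sub>R norm w))"
      unfolding l_def using False by (intro vmin) simp
    also have "\<dots> = (w \<bullet> (M *v w)) / (w \<bullet> w)"
      by (simp add: matrix_vector_mult_scaleR dot_square_norm power2_eq_square divide_inverse)
    finally show ?thesis
      using False by (simp add: field_simps)
  qed simp
  have Msym: "w \<bullet> (M *v u) = u \<bullet> (M *v w)" for u w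
    using dot_lmul_matrix[of u M w] sym
    by (metis inner_commute transpose_matrix_vector)
  \<comment> \<open>\<open>N\<close> stands for \<open>M - l\<close>, whose form is non-negative and
    vanishes at \<open>v\<close>. Moving from \<open>v\<close> in any direction \<open>w\<close>
    cannot decrease it, so the first-order term \<open>w \<bullet> N v\<close> must be zero.\<close>
  define N where "N = (\<lambda>w. M *v w - l *\<^sub>R w)"
  have "w \<bullet> N v = 0" for w
  proof -
    have nn: "0 \<le> 2 * t * (w \<bullet> N v) + t\<^sup>2 * (w \<bullet> N w)" for t
    proof -
      have "0 \<le> (v + t *\<^sub>R w) \<bullet> N (v + t *\<^sub>R w)"
        using *[of "v + t *\<^sub>R w"] by (simp add: N_def inner_diff_right)
      also have "\<dots> = v \<bullet> N v + 2 * t * (w \<bullet> N v) + t\<^sup>2 * (w \<bullet> N w)"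
        using Msym[of v w]
        by (simp add: N_def algebra_simps inner_simps matrix_vector_right_distrib
            matrix_vector_mult_scaleR power2_eq_square inner_commute[of w v])
      also have "v \<bullet> N v = 0" using vv by (simp add: N_def l_def inner_simps)
      finally show ?thesis by simp
    qed
    define a where "a = w \<bullet> N v"
    \<comment> \<open>The summand 1 keeps \<open>b\<close> positive when
      \<open>w \<bullet> N w\<close> vanishes. With \<open>t = -a/b\<close> the quadratic polynomial
      in \<open>t\<close> is at most \<open>-a^2/b\<close>.\<close>
    define b where "b = \<bar>w \<bullet> N w\<bar> + 1"
    have bpos: "b > 0" by (simp add: b_def)
    have "0 \<le> 2 * (-a/b) * a + (-a/b)\<^sup>2 * (w \<bullet> N w)"
      using nn[of "-a/b"] by (simp add: a_def)
    also have "\<dots> \<le> 2 * (-a/b) * a + (-a/b)\<^sup>2 * b"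
      by (intro add_left_mono mult_left_mono) (auto simp: b_def)
    also have "\<dots> = - (a\<^sup>2 / b)"
      using bpos by (simp add: field_simps power2_eq_square)
    finally have "a\<^sup>2 / b \<le> 0" by simp
    then have "a\<^sup>2 \<le> 0" using bpos by (simp add: divide_le_0_iff)
    then show ?thesis by (simp add: a_def)
  qed
  from this[of "N v"] have "N v = 0" by simp
  then have "M *v v = l *\<^sub>R v" by (simp add: N_def)
  moreover have "v \<noteq> 0" using vn by auto
  ultimately show ?thesis using that * by blast
qed

text \<open>From left to right the least eigenvalue bounds the form from below, so its sign decides
  that of the form; from right to left the form is evaluated at an eigenvector. The derivative along
  the flow delivers the right-hand side.\<close>

lemma nonneg_selfadjoint_iff:
  "nonneg_selfadjoint M \<longleftrightarrow> transpose M = M \<and> (\<forall>v. v \<noteq> 0 \<longrightarrow> 0 \<le> v \<bullet> (M *v v))"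
proof (intro iffI conjI allI impI)
  assume L: "nonneg_selfadjoint M"
  then show "transpose M = M" by (simp add: nonneg_selfadjoint_def)
  then obtain l v where *: "v \<noteq> 0" "M *v v = l *\<^sub>R v" "\<And>w. l * (w \<bullet> w) \<le> w \<bullet> (M *v w)"
    by (rule symmetric_matrix_least_eigenvalue) blast
  then have "0 \<le> l" using L by (auto simp: nonneg_selfadjoint_def)
  then show "0 \<le> w \<bullet> (M *v w)" for w
    using *(3)[of w] by (meson inner_ge_zero mult_nonneg_nonneg order_trans)
next
  assume R: "transpose M = M \<and> (\<forall>v. v \<noteq> 0 \<longrightarrow> 0 \<le> v \<bullet> (M *v v))"
  have "0 \<le> l" if "v \<noteq> 0" "M *v v = l *\<^sub>R v" for l v
    using R that inner_gt_zero_iff[of v] by (metis inner_scaleR_right zero_le_mult_iff not_less)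
  with R show "nonneg_selfadjoint M" by (auto simp: nonneg_selfadjoint_def)
qed

lemma pos_selfadjoint_iff:
  "pos_selfadjoint M \<longleftrightarrow> transpose M = M \<and> (\<forall>v. v \<noteq> 0 \<longrightarrow> 0 < v \<bullet> (M *v v))"
proof (intro iffI conjI allI impI)
  assume L: "pos_selfadjoint M"
  then show "transpose M = M" by (simp add: pos_selfadjoint_def)
  then obtain l v where *: "v \<noteq> 0" "M *v v = l *\<^sub>R v" "\<And>w. l * (w \<bullet> w) \<le> w \<bullet> (M *v w)"
    by (rule symmetric_matrix_least_eigenvalue) blast
  then have "0 < l" using L by (auto simp: pos_selfadjoint_def)
  then show "0 < w \<bullet> (M *v w)" if "w \<noteq> 0" for w
    using *(3)[of w] that by (meson inner_gt_zero_iff mult_pos_pos less_le_trans)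
next
  assume R: "transpose M = M \<and> (\<forall>v. v \<noteq> 0 \<longrightarrow> 0 < v \<bullet> (M *v v))"
  have "0 < l" if "v \<noteq> 0" "M *v v = l *\<^sub>R v" for l v
    using R that inner_gt_zero_iff[of v] by (metis inner_scaleR_right zero_less_mult_iff not_less_iff_gr_or_eq)
  with R show "pos_selfadjoint M" by (auto simp: pos_selfadjoint_def)
qed


section \<open>Pseudo-orthonormal families of an indefinite form, and its index\<close>

lemma pseudo_orthonormal_coords:
  fixes B :: "'v::real_vector \<Rightarrow> 'v \<Rightarrow> real"
  assumes lin: "\<And>w. linear (\<lambda>u. B u w)" and fin: "finite K"
    and orth: "\<And>i k. i \<in> K \<Longrightarrow> k \<in> K \<Longrightarrow> B (b i) (b k) = (if i = k then s i else 0)"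
    and k: "k \<in> K"
  shows "B (\<Sum>i\<in>K. a i *\<^sub>R b i) (b k) = a k * s k"
proof -
  interpret l: linear "\<lambda>u. B u (b k)" by (rule lin)
  have "B (\<Sum>i\<in>K. a i *\<^sub>R b i) (b k) = (\<Sum>i\<in>K. if i = k then a i * s i else 0)"
    unfolding l.sum by (intro sum.cong) (auto simp: l.scaleR orth k)
  also have "\<dots> = a k * s k" using fin k by simp
  finally show ?thesis .
qed

lemma bilinear_linears:
  assumes "bilinear B"
  shows "linear (\<lambda>u. B u w)" "linear (B w)"
  using assms by (auto simp: bilinear_def)

lemma pseudo_orthonormal_diag:
  fixes B :: "'v::real_vector \<Rightarrow> 'v \<Rightarrow> real"
  assumes bil: "bilinear B" and fin: "finite K"
    and orth: "\<And>i k. i \<in> K \<Longrightarrow> k \<in> K \<Longrightarrow> B (b i) (b k) = (if i = k then s i else 0)"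
  shows "B (\<Sum>i\<in>K. a i *\<^sub>R b i) (\<Sum>i\<in>K. a i *\<^sub>R b i) = (\<Sum>i\<in>K. s i * (a i)\<^sup>2)"
proof -
  note lin = bilinear_linears[OF bil]
  have "B (\<Sum>i\<in>K. a i *\<^sub>R b i) (\<Sum>i\<in>K. a i *\<^sub>R b i) = (\<Sum>k\<in>K. a k * B (\<Sum>i\<in>K. a i *\<^sub>R b i) (b k))"
    by (subst linear_sum[OF lin(2)]) (simp add: linear_scale[OF lin(2)])
  also have "\<dots> = (\<Sum>k\<in>K. s k * (a k)\<^sup>2)"
    by (intro sum.cong refl)
      (simp add: pseudo_orthonormal_coords[where B=B and b=b and s=s, OF lin(1) fin orth] power2_eq_square)
  finally show ?thesis .
qed

text \<open>Pairing a vanishing combination with \<open>b k\<close> isolates its \<open>k\<close>-th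
  coefficient. Non-isotropy of each vector does the work that definiteness does for ordinary
  orthogonal families.\<close>

lemma pseudo_orthonormal_imp_independent:
  fixes B :: "'v::real_vector \<Rightarrow> 'v \<Rightarrow> real"
  assumes lin: "\<And>w. linear (\<lambda>u. B u w)" and fin: "finite K"
    and orth: "\<And>i k. i \<in> K \<Longrightarrow> k \<in> K \<Longrightarrow> B (b i) (b k) = (if i = k then s i else 0)"
    and s: "\<And>i. i \<in> K \<Longrightarrow> s i \<noteq> 0"
  shows "inj_on b K" "independent (b ` K)"
proof -
  show inj: "inj_on b K"
  proof (rule inj_onI)
    fix i k assume "i \<in> K" "k \<in> K" "b i = b k"
    then show "i = k" using orth[of i k] orth[of k k] s[of k] by metis
  qed
  show "independent (b ` K)"
  proof (rule independent_if_scalars_zero)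
    show "finite (b ` K)" using fin by simp
    fix f x assume 0: "(\<Sum>x\<in>b ` K. f x *\<^sub>R x) = 0" and "x \<in> b ` K"
    then obtain k where k: "k \<in> K" "x = b k" by auto
    have "(\<Sum>i\<in>K. f (b i) *\<^sub>R b i) = 0"
      using 0 by (simp add: sum.reindex[OF inj])
    then have "f (b k) * s k = 0"
      using pseudo_orthonormal_coords[OF lin fin orth k(1), of "\<lambda>i. f (b i)"]
      linear_0[OF lin[of "b k"]] by simp
    then show "f x = 0" using s k by simp
  qed
qed

text \<open>The danger of an indefinite form is that all vectors orthogonal to \<open>S\<close>
  might be isotropic. Polarisation would then make each of them orthogonal to all the others as well
  as to \<open>S\<close>, hence to everything, against non-degeneracy; so a vector that can be
  normalised exists.\<close>

lemma pseudo_orthonormal_extend: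
  fixes B :: "'v::euclidean_space \<Rightarrow> 'v \<Rightarrow> real"
  assumes bil: "bilinear B" and symB: "\<And>u v. B u v = B v u"
    and nondeg: "\<And>v. (\<And>w. B v w = 0) \<Longrightarrow> v = 0"
    and fin: "finite S"
    and orth: "\<And>u v. u \<in> S \<Longrightarrow> v \<in> S \<Longrightarrow> u \<noteq> v \<Longrightarrow> B u v = 0"
    and unit: "\<And>u. u \<in> S \<Longrightarrow> \<bar>B u u\<bar> = 1" and span: "span S \<noteq> UNIV"
  obtains w where "w \<notin> S" "\<bar>B w w\<bar> = 1" "\<And>u. u \<in> S \<Longrightarrow> B u w = 0"
proof -
  note lin = bilinear_linears[OF bil]
  \<comment> \<open>\<open>r v\<close> is \<open>v\<close> minus its projection to
    \<open>span S\<close>. The coefficients should be divided by \<open>B s s\<close>, which is 1 or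
    -1, so multiplying is the same.\<close>
  define r where "r v = v - (\<Sum>s\<in>S. (B v s * B s s) *\<^sub>R s)" for v
  have rS: "B (r v) u = 0" if "u \<in> S" for v u
  proof -
    have "B (\<Sum>s\<in>S. (B v s * B s s) *\<^sub>R s) u = (B v u * B u u) * B u u"
      by (rule pseudo_orthonormal_coords[of B S "\<lambda>x. x" "\<lambda>x. B x x"])
        (use lin fin orth that in auto)
    also have "\<dots> = B v u"
      using unit[OF that] by (metis abs_mult_self_eq mult.assoc mult.right_neutral)
    finally show ?thesis by (simp add: r_def linear_diff[OF lin(1)])
  qed
  have sumS: "(\<Sum>s\<in>S. (B v s * B s s) *\<^sub>R s) \<in> span S" for v
    by (intro span_sum span_scale span_base)
  obtain v where v: "v \<notin> span S" using span by auto
  then have rv: "r v \<noteq> 0" using sumS[of v] by (auto simp: r_def)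
  have "\<exists>w. (\<forall>u\<in>S. B w u = 0) \<and> B w w \<noteq> 0"
  proof (rule ccontr)
    assume "\<not> ?thesis"
    then have iso: "B w w = 0" if "\<forall>u\<in>S. B w u = 0" for w using that by auto
    have "B (r v) w = 0" for w
    proof -
      have "B (r v + r w) (r v + r w) = 0" "B (r v) (r v) = 0" "B (r w) (r w) = 0"
        by (rule iso; simp add: rS linear_add[OF lin(1)])+
      then have "B (r v) (r w) = 0"
        using symB[of "r w" "r v"] by (simp add: bilinear_ladd[OF bil] bilinear_radd[OF bil])
      moreover have "B (r v) (\<Sum>s\<in>S. (B w s * B s s) *\<^sub>R s) = 0"
        by (simp add: linear_sum[OF lin(2)] linear_scale[OF lin(2)] rS)
      moreover have "w = r w + (\<Sum>s\<in>S. (B w s * B s s) *\<^sub>R s)" by (simp add: r_def)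
      ultimately show ?thesis by (metis linear_add[OF lin(2)] add.right_neutral)
    qed
    with nondeg rv show False by blast
  qed
  then obtain w where w: "\<And>u. u \<in> S \<Longrightarrow> B w u = 0" "B w w \<noteq> 0" by auto
  define w' where "w' = w /\<^sub>R sqrt \<bar>B w w\<bar>"
  show ?thesis
  proof
    show "\<bar>B w' w'\<bar> = 1"
      using w(2) by (simp add: w'_def bilinear_lmul[OF bil] bilinear_rmul[OF bil] abs_mult divide_simps flip: power2_eq_square)
    show *: "B u w' = 0" if "u \<in> S" for u
      using w(1)[OF that] symB[of u w] by (simp add: w'_def bilinear_rmul[OF bil])
    show "w' \<notin> S" using * unit \<open>\<bar>B w' w'\<bar> = 1\<close> by force
  qed
qed

text \<open>Independence bounds the cardinality of pseudo-orthonormal sets through \<open>b0\<close>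
  by the dimension. One of greatest cardinality must span, since otherwise it could be extended. The
  prescribed member \<open>b0\<close> will be the normalised vector field.\<close>

lemma pseudo_orthonormal_basis_exists:
  fixes B :: "'v::euclidean_space \<Rightarrow> 'v \<Rightarrow> real"
  assumes bil: "bilinear B" and symB: "\<And>u v. B u v = B v u"
    and nondeg: "\<And>v. (\<And>w. B v w = 0) \<Longrightarrow> v = 0" and b0: "B b0 b0 = 1"
  obtains S where "b0 \<in> S" "finite S" "independent S" "span S = UNIV" "card S = DIM('v)"
    "\<And>u v. u \<in> S \<Longrightarrow> v \<in> S \<Longrightarrow> u \<noteq> v \<Longrightarrow> B u v = 0" "\<And>u. u \<in> S \<Longrightarrow> \<bar>B u u\<bar> = 1"
proof -
  define P where "P S \<longleftrightarrow> b0 \<in> S \<and> finite S \<and> (\<forall>u\<in>S. \<forall>v\<in>S. u \<noteq> v \<longrightarrow> B u v = 0) \<and> (\<forall>u\<in>S. \<bar>B u u\<bar> = 1)" for S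
  have ind: "independent S" if "P S" for S
    using pseudo_orthonormal_imp_independent(2)[of B S "\<lambda>x. x" "\<lambda>x. B x x"] that bilinear_linears[OF bil]
    by (fastforce simp: P_def)
  have "P {b0}" using b0 by (simp add: P_def)
  moreover have "\<forall>S. P S \<longrightarrow> card S < Suc (DIM('v))"
    using ind independent_bound less_Suc_eq_le by blast
  ultimately obtain S where S: "P S" and max: "\<And>T. P T \<Longrightarrow> card T \<le> card S"
    using ex_has_greatest_nat[of P "{b0}" card "Suc (DIM('v))"] by auto
  have span: "span S = UNIV"
  proof (rule ccontr)
    assume "span S \<noteq> UNIV"
    then obtain w where w: "w \<notin> S" "\<bar>B w w\<bar> = 1" "\<And>u. u \<in> S \<Longrightarrow> B u w = 0"
      using pseudo_orthonormal_extend[OF bil symB nondeg, of S] S by (auto simp: P_def)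
    then have "P (insert w S)" using S symB by (auto simp: P_def)
    from max[OF this] show False using w(1) S by (simp add: P_def)
  qed
  have "card S = DIM('v)"
    using dim_eq_card[of S UNIV] span ind[OF S] by (simp add: dim_UNIV)
  with that S span ind[OF S] show ?thesis by (auto simp: P_def)
qed

text \<open>Sylvester's law of inertia. The negative vectors span a non-positive subspace, so there
  are at most \<open>q\<close> of them. A non-positive subspace of dimension \<open>q\<close> meets
  the span of the positive vectors only in 0, so there are at most \<open>DIM('v) - q\<close>
  positive ones, and the two counts add up to the dimension.\<close>

lemma card_negative_eq_index:
  fixes B :: "'v::euclidean_space \<Rightarrow> 'v \<Rightarrow> real"
  assumes bil: "bilinear B" 
    and S: "finite S" "independent S" "card S = DIM('v)"
    and orth: "\<And>u v. u \<in> S \<Longrightarrow> v \<in> S \<Longrightarrow> u \<noteq> v \<Longrightarrow> B u v = 0" and unit: "\<And>u. u \<in> S \<Longrightarrow> \<bar>B u u\<bar> = 1"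
    and idx: "has_index_on UNIV (\<lambda>v. B v v) q"
  shows "card {u \<in> S. B u u < 0} = q"
proof -
  note lin = bilinear_linears[OF bil]
  define Sm where "Sm = {u \<in> S. B u u < 0}"
  define Sp where "Sp = {u \<in> S. 0 \<le> B u u}"
  have fin: "finite Sm" "finite Sp" using S by (auto simp: Sm_def Sp_def)
  have sub: "Sm \<subseteq> S" "Sp \<subseteq> S" by (auto simp: Sm_def Sp_def)
  have diag: "B (\<Sum>u\<in>T. a u *\<^sub>R u) (\<Sum>u\<in>T. a u *\<^sub>R u) = (\<Sum>u\<in>T. B u u * (a u)\<^sup>2)" if "T \<subseteq> S" for T a
    using that orth finite_subset[OF that S(1)]
    by (intro pseudo_orthonormal_diag[OF bil, where b="\<lambda>x. x"]) (auto simp: subset_iff)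
  have nonpos: "B v v \<le> 0" if v: "v \<in> span Sm" for v
  proof -
    obtain a where "v = (\<Sum>u\<in>Sm. a u *\<^sub>R u)" using v span_finite[OF fin(1)] by auto
    then have "B v v = (\<Sum>u\<in>Sm. B u u * (a u)\<^sup>2)" using diag sub by simp
    also have "\<dots> \<le> 0" by (intro sum_nonpos) (auto simp: Sm_def mult_nonpos_nonneg)
    finally show ?thesis .
  qed
  have pos: "v = 0" if v: "v \<in> span Sp" and "B v v \<le> 0" for v
  proof -
    obtain a where a: "v = (\<Sum>u\<in>Sp. a u *\<^sub>R u)" using v span_finite[OF fin(2)] by auto
    have "B v v = (\<Sum>u\<in>Sp. B u u * (a u)\<^sup>2)" using diag sub a by simp
    also have "\<dots> = (\<Sum>u\<in>Sp. (a u)\<^sup>2)"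
      by (intro sum.cong) (use unit in \<open>fastforce simp: Sp_def\<close>)+
    finally have "(\<Sum>u\<in>Sp. (a u)\<^sup>2) = 0" using that(2) sum_nonneg[of Sp "\<lambda>u. (a u)\<^sup>2"] by simp
    then have "\<forall>u\<in>Sp. a u = 0" using fin by (simp add: sum_nonneg_eq_0_iff)
    then show ?thesis using a by simp
  qed
  have indm: "independent Sm" and indp: "independent Sp"
    using S(2) independent_mono sub by blast+
  have "card Sm \<le> q"
  proof -
    have "dim (span Sm) \<le> q"
      using idx nonpos subspace_span unfolding has_index_on_def by blast
    then show ?thesis using indm by (simp add: dim_eq_card_independent)
  qed
  moreover have "q + card Sp \<le> DIM('v)"
  proof -
    obtain V where V: "subspace V" "\<forall>v\<in>V. B v v \<le> 0" "dim V = q"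
      using idx by (auto simp: has_index_on_def)
    have "V \<inter> span Sp = {0}" using V pos subspace_0[of V] span_zero by blast
    moreover have "dim {x + y |x y. x \<in> V \<and> y \<in> span Sp} + dim (V \<inter> span Sp) = dim V + dim (span Sp)"
      by (rule dim_sums_Int) (use V in auto)
    ultimately have "dim V + dim (span Sp) = dim {x + y |x y. x \<in> V \<and> y \<in> span Sp}" by simp
    also have "\<dots> \<le> DIM('v)" by (rule dim_subset_UNIV)
    finally show ?thesis using V(3) indp by (simp add: dim_eq_card_independent)
  qed
  moreover have "card Sm + card Sp = DIM('v)"
  proof -
    have "S = Sm \<union> Sp" "Sm \<inter> Sp = {}" by (auto simp: Sm_def Sp_def)
    then show ?thesis using card_Un_disjoint[OF fin] S(3) by simp
  qed
  ultimately show ?thesis by (simp add: Sm_def)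
qed

text \<open>The unordered basis is indexed so that its negative vectors sit exactly at the indices
  in \<open>I\<close>. The vector \<open>b0\<close> is positive, so it can be given any index
  \<open>j\<close> outside \<open>I\<close>.\<close>

lemma signed_basis_exists:
  fixes B :: "real^'n \<Rightarrow> real^'n \<Rightarrow> real"
  assumes bil: "bilinear B" and symB: "\<And>u v. B u v = B v u"
    and nondeg: "\<And>v. (\<And>w. B v w = 0) \<Longrightarrow> v = 0" and b0: "B b0 b0 = 1"
    and idx: "has_index_on UNIV (\<lambda>v. B v v) q" and I: "card I = q" "j \<notin> I"
  obtains b :: "'n \<Rightarrow> real^'n" where "b j = b0"
    "\<And>i k. B (b i) (b k) = (if i = k then (if i \<in> I then -1 else 1) else 0)"
proof -
  obtain S where S: "b0 \<in> S" "finite S" "independent S" "card S = DIM(real^'n)"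
    and orth: "\<And>u v. u \<in> S \<Longrightarrow> v \<in> S \<Longrightarrow> u \<noteq> v \<Longrightarrow> B u v = 0" and unit: "\<And>u. u \<in> S \<Longrightarrow> \<bar>B u u\<bar> = 1"
    using pseudo_orthonormal_basis_exists[OF bil symB nondeg b0] by metis
  define Sm where "Sm = {u \<in> S. B u u < 0}"
  have Sm: "card Sm = q" "Sm \<subseteq> S" "finite Sm"
    using card_negative_eq_index[OF bil S(2-4) orth unit idx] S by (auto simp: Sm_def)
  have b0m: "b0 \<notin> Sm" using b0 by (simp add: Sm_def)
  obtain f where f: "bij_betw f I Sm"
    using finite_same_card_bij[of I Sm] Sm I(1) by auto
  \<comment> \<open>Both sides equal \<open>n - q - 1\<close>: the positive places other than
    \<open>j\<close>, and the positive basis vectors other than \<open>b0\<close>.\<close>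
  have "card (- I - {j}) = card (S - Sm - {b0})"
    using S Sm b0m I by (simp add: card_Diff_subset Compl_eq_Diff_UNIV)
  then obtain g where g: "bij_betw g (- I - {j}) (S - Sm - {b0})"
    using finite_same_card_bij[of "- I - {j}" "S - Sm - {b0}"] S by auto
  define b where "b i = (if i \<in> I then f i else if i = j then b0 else g i)" for i
  have bI: "b i \<in> Sm" if "i \<in> I" for i using f that by (auto simp: b_def bij_betw_def)
  have bnI: "b i \<in> S - Sm" if "i \<notin> I" for i
    using g that S b0m by (auto simp: b_def bij_betw_def)
  have inj: "i = k" if "b i = b k" for i k
  proof -
    have "i \<in> I \<longleftrightarrow> k \<in> I" using bI bnI that by force
    then show ?thesis
      using that f g I
      by (smt (verit) b_def bij_betwE bij_betw_inv_into_left Diff_iff ComplI singleton_iff singletonI)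
  qed
  have "B (b i) (b k) = (if i = k then (if i \<in> I then -1 else 1) else 0)" for i k
  proof (cases "i = k")
    case True
    then show ?thesis using bI[of i] bnI[of i] unit[of "b i"] by (auto simp: Sm_def)
  next
    case False
    then have "b i \<noteq> b k" using inj by blast
    moreover have "b i \<in> S" "b k \<in> S" using bI bnI Sm by (metis DiffD1 subsetD)+
    ultimately show ?thesis using orth False by auto
  qed
  moreover have "b j = b0" using I by (simp add: b_def)
  ultimately show ?thesis using that by blast
qed

section \<open>Matrices in adapted coordinates\<close>

lemma J_mat_mult: "J_mat I *v \<alpha> = (\<chi> i. (if i \<in> I then -1 else 1) * \<alpha> $ i)"
proof -
  have "(\<Sum>k\<in>UNIV. (if i = k then (if i \<in> I then -1 else 1) else 0) * \<alpha> $ k) =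
      (if i \<in> I then -1 else 1) * \<alpha> $ i" for i
    by (subst sum.cong[OF refl, where h="\<lambda>k. if k = i then (if i \<in> I then -1 else 1) * \<alpha> $ i else 0"]) auto
  then show ?thesis by (simp add: J_mat_def matrix_vector_mult_def vec_eq_iff)
qed

lemma transpose_J_mat: "transpose (J_mat I) = J_mat I"
  by (auto simp: J_mat_def transpose_def vec_eq_iff)

lemma inner_vector_matrix_mult:
  fixes M :: "real^'n^'m"
  shows "v \<bullet> (w v* M) = (M *v v) \<bullet> w"
  using dot_lmul_matrix[of w M v] by (simp add: inner_commute)

text \<open>Reduces the differentiability of a matrix-valued function to that of its
  entries.\<close>

lemma matrix_eq_sum_axis:
  fixes M :: "real^'n^'m"
  shows "M = (\<Sum>i\<in>UNIV. \<Sum>k\<in>UNIV. (M $ i $ k) *\<^sub>R axis i (axis k 1))"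
proof -
  have "(\<Sum>i\<in>UNIV. \<Sum>k\<in>UNIV. (M $ i $ k) *\<^sub>R axis i (axis k (1::real))) $ a $ b = M $ a $ b" for a b
  proof -
    have "(\<Sum>i\<in>UNIV. \<Sum>k\<in>UNIV. (M $ i $ k) *\<^sub>R axis i (axis k (1::real))) $ a $ b =
      (\<Sum>i\<in>UNIV. \<Sum>k\<in>UNIV. if k = b then (if i = a then M $ a $ b else 0) else 0)"
      unfolding sum_component by (intro sum.cong refl) (auto simp: axis_def)
    also have "\<dots> = M $ a $ b" by simp
    finally show ?thesis .
  qed
  then show ?thesis by (simp add: vec_eq_iff)
qed

definition drop_coord :: "'n \<Rightarrow> real^'n \<Rightarrow> real^'n" where
  "drop_coord j \<alpha> = (\<chi> i. if i = j then 0 else \<alpha> $ i)"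

lemma linear_drop_coord: "linear (drop_coord j)"
  by (rule linearI) (auto simp: drop_coord_def vec_eq_iff)


section \<open>Functions that are differentiable along a flow\<close>

text \<open>Forms and frames are continuous in the point and differentiable only along orbits, so
  the two properties travel together. Continuity keeps positive functions positive near a point; the
  derivative along orbits is what the cocycle matrix needs.\<close>

definition C1_on_orbits ::
  "(real \<Rightarrow> 'm \<Rightarrow> 'm) \<Rightarrow> 'm::topological_space set \<Rightarrow> ('m \<Rightarrow> 'b::real_normed_vector) \<Rightarrow> bool" where
  "C1_on_orbits Xt S f \<longleftrightarrow> continuous_on S f \<and> C1_along_flow_on Xt S f"

lemma C1_on_orbitsI:
  assumes "continuous_on S f"
    and "\<And>x. x \<in> S \<Longrightarrow> continuous_on {t. Xt t x \<in> S} (f' x)"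
    and "\<And>x t. x \<in> S \<Longrightarrow> Xt t x \<in> S \<Longrightarrow>
      ((\<lambda>s. f (Xt s x)) has_vector_derivative f' x t) (at t within {s. Xt s x \<in> S})"
  shows "C1_on_orbits Xt S f"
  unfolding C1_on_orbits_def C1_along_flow_on_def using assms by blast

text \<open>The third conclusion follows from the second. It is recorded because the derivative of a
  product contains undifferentiated factors, whose continuity along the orbit is then
  required.\<close>

lemma C1_on_orbitsE:
  assumes "C1_on_orbits Xt S f"
  obtains f' where "\<And>x. x \<in> S \<Longrightarrow> continuous_on {t. Xt t x \<in> S} (f' x)"
    "\<And>x t. x \<in> S \<Longrightarrow> Xt t x \<in> S \<Longrightarrow>
      ((\<lambda>s. f (Xt s x)) has_vector_derivative f' x t) (at t within {s. Xt s x \<in> S})"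
    "\<And>x. x \<in> S \<Longrightarrow> continuous_on {t. Xt t x \<in> S} (\<lambda>t. f (Xt t x))"
proof -
  obtain f' where f': "\<forall>x\<in>S. continuous_on {t. Xt t x \<in> S} (f' x) \<and> (\<forall>t. Xt t x \<in> S \<longrightarrow>
      ((\<lambda>s. f (Xt s x)) has_vector_derivative f' x t) (at t within {s. Xt s x \<in> S}))"
    using assms unfolding C1_on_orbits_def C1_along_flow_on_def by metis
  then have "continuous_on {t. Xt t x \<in> S} (\<lambda>t. f (Xt t x))" if "x \<in> S" for x
    unfolding continuous_on_eq_continuous_within
    using that has_vector_derivative_continuous by fastforce
  with that f' show ?thesis by blast
qed

lemma C1_on_orbits_continuous: "C1_on_orbits Xt S f \<Longrightarrow> continuous_on S f"
  by (simp add: C1_on_orbits_def)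

lemma C1_on_orbits_subset:
  assumes "C1_on_orbits Xt S f" "S' \<subseteq> S"
  shows "C1_on_orbits Xt S' f"
proof -
  obtain f' where f': "\<And>x. x \<in> S \<Longrightarrow> continuous_on {t. Xt t x \<in> S} (f' x)"
    "\<And>x t. x \<in> S \<Longrightarrow> Xt t x \<in> S \<Longrightarrow>
      ((\<lambda>s. f (Xt s x)) has_vector_derivative f' x t) (at t within {s. Xt s x \<in> S})"
    using C1_on_orbitsE[OF assms(1)] by metis
  have sub: "{s. Xt s x \<in> S'} \<subseteq> {s. Xt s x \<in> S}" for x using assms(2) by auto
  show ?thesis
    using assms(2)
    by (intro C1_on_orbitsI[where f'=f'] continuous_on_subset[OF C1_on_orbits_continuous[OF assms(1)]]
        continuous_on_subset[OF f'(1) sub] has_vector_derivative_within_subset[OF f'(2) sub]) auto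
qed

lemma C1_on_orbits_cong:
  assumes "C1_on_orbits Xt S f" "\<And>y. y \<in> S \<Longrightarrow> g y = f y"
  shows "C1_on_orbits Xt S g"
proof -
  obtain f' where f': "\<And>x. x \<in> S \<Longrightarrow> continuous_on {t. Xt t x \<in> S} (f' x)"
    "\<And>x t. x \<in> S \<Longrightarrow> Xt t x \<in> S \<Longrightarrow>
      ((\<lambda>s. f (Xt s x)) has_vector_derivative f' x t) (at t within {s. Xt s x \<in> S})"
    using C1_on_orbitsE[OF assms(1)] by metis
  show ?thesis
  proof (rule C1_on_orbitsI[where f'=f'])
    show "continuous_on S g"
      using C1_on_orbits_continuous[OF assms(1)] assms(2) by (simp cong: continuous_on_cong)
    show "((\<lambda>s. g (Xt s x)) has_vector_derivative f' x t) (at t within {s. Xt s x \<in> S})"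
      if "x \<in> S" "Xt t x \<in> S" for x t
      by (rule has_vector_derivative_transform[OF _ _ f'(2)[OF that]]) (use that assms(2) in auto)
  qed (use f' in auto)
qed

lemma C1_on_orbits_const: "C1_on_orbits Xt S (\<lambda>y. c)"
  by (rule C1_on_orbitsI[where f'="\<lambda>_ _. 0"]) auto

text \<open>One product rule serves real products, scaling and, with a constant factor in the inner
  product, coordinate projections.\<close>

lemma (in bounded_bilinear) C1_on_orbits:
  assumes "C1_on_orbits Xt S f" "C1_on_orbits Xt S g"
  shows "C1_on_orbits Xt S (\<lambda>y. prod (f y) (g y))"
proof -
  obtain f' where f': "\<And>x. x \<in> S \<Longrightarrow> continuous_on {t. Xt t x \<in> S} (f' x)"
    "\<And>x t. x \<in> S \<Longrightarrow> Xt t x \<in> S \<Longrightarrow>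
      ((\<lambda>s. f (Xt s x)) has_vector_derivative f' x t) (at t within {s. Xt s x \<in> S})"
    "\<And>x. x \<in> S \<Longrightarrow> continuous_on {t. Xt t x \<in> S} (\<lambda>t. f (Xt t x))"
    using C1_on_orbitsE[OF assms(1)] by metis
  obtain g' where g': "\<And>x. x \<in> S \<Longrightarrow> continuous_on {t. Xt t x \<in> S} (g' x)"
    "\<And>x t. x \<in> S \<Longrightarrow> Xt t x \<in> S \<Longrightarrow>
      ((\<lambda>s. g (Xt s x)) has_vector_derivative g' x t) (at t within {s. Xt s x \<in> S})"
    "\<And>x. x \<in> S \<Longrightarrow> continuous_on {t. Xt t x \<in> S} (\<lambda>t. g (Xt t x))"
    using C1_on_orbitsE[OF assms(2)] by metis
  show ?thesis
    by (rule C1_on_orbitsI[where f'="\<lambda>x t. prod (f (Xt t x)) (g' x t) + prod (f' x t) (g (Xt t x))"])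
      (intro continuous_intros continuous_on has_vector_derivative f' g'
        C1_on_orbits_continuous[OF assms(1)] C1_on_orbits_continuous[OF assms(2)]; assumption)+
qed

lemma C1_on_orbits_add:
  assumes "C1_on_orbits Xt S f" "C1_on_orbits Xt S g"
  shows "C1_on_orbits Xt S (\<lambda>y. f y + g y)"
proof -
  obtain f' where f': "\<And>x. x \<in> S \<Longrightarrow> continuous_on {t. Xt t x \<in> S} (f' x)"
    "\<And>x t. x \<in> S \<Longrightarrow> Xt t x \<in> S \<Longrightarrow>
      ((\<lambda>s. f (Xt s x)) has_vector_derivative f' x t) (at t within {s. Xt s x \<in> S})"
    using C1_on_orbitsE[OF assms(1)] by metis
  obtain g' where g': "\<And>x. x \<in> S \<Longrightarrow> continuous_on {t. Xt t x \<in> S} (g' x)"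
    "\<And>x t. x \<in> S \<Longrightarrow> Xt t x \<in> S \<Longrightarrow>
      ((\<lambda>s. g (Xt s x)) has_vector_derivative g' x t) (at t within {s. Xt s x \<in> S})"
    using C1_on_orbitsE[OF assms(2)] by metis
  show ?thesis
    by (rule C1_on_orbitsI[where f'="\<lambda>x t. f' x t + g' x t"])
      (intro continuous_intros has_vector_derivative_add f' g'
        C1_on_orbits_continuous[OF assms(1)] C1_on_orbits_continuous[OF assms(2)]; assumption)+
qed

lemmas C1_on_orbits_scaleR = bounded_bilinear.C1_on_orbits[OF bounded_bilinear_scaleR]
lemmas C1_on_orbits_mult =
  bounded_bilinear.C1_on_orbits[OF bounded_bilinear_mult]

lemma C1_on_orbits_diff:
  assumes "C1_on_orbits Xt S f" "C1_on_orbits Xt S g"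
  shows "C1_on_orbits Xt S (\<lambda>y. f y - g y)"
  using C1_on_orbits_add[OF assms(1) C1_on_orbits_scaleR[OF C1_on_orbits_const[of _ _ "-1"] assms(2)]]
  by simp

lemma C1_on_orbits_sum:
  assumes "\<And>i. i \<in> K \<Longrightarrow> C1_on_orbits Xt S (f i)"
  shows "C1_on_orbits Xt S (\<lambda>y. \<Sum>i\<in>K. f i y)"
  using assms by (induction K rule: infinite_finite_induct) (auto intro: C1_on_orbits_const C1_on_orbits_add)

lemma C1_on_orbits_nth:
  fixes f :: "'m::topological_space \<Rightarrow> real^'n"
  assumes "C1_on_orbits Xt S f"
  shows "C1_on_orbits Xt S (\<lambda>y. f y $ i)"
  using bounded_bilinear.C1_on_orbits[OF bounded_bilinear_inner assms C1_on_orbits_const[of _ _ "axis i 1"]]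
  by (simp add: inner_axis)

lemma C1_on_orbits_inverse_sqrt:
  fixes f :: "'m::topological_space \<Rightarrow> real"
  assumes "C1_on_orbits Xt S f" and pos: "\<And>y. y \<in> S \<Longrightarrow> 0 < f y"
  shows "C1_on_orbits Xt S (\<lambda>y. inverse (sqrt (f y)))"
proof -
  obtain f' where f': "\<And>x. x \<in> S \<Longrightarrow> continuous_on {t. Xt t x \<in> S} (f' x)"
    "\<And>x t. x \<in> S \<Longrightarrow> Xt t x \<in> S \<Longrightarrow>
      ((\<lambda>s. f (Xt s x)) has_vector_derivative f' x t) (at t within {s. Xt s x \<in> S})"
    "\<And>x. x \<in> S \<Longrightarrow> continuous_on {t. Xt t x \<in> S} (\<lambda>t. f (Xt t x))"
    using C1_on_orbitsE[OF assms(1)] by metis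
  \<comment> \<open>The derivative of \<open>1 / sqrt z\<close>, left in the shape that the rule for
    inverses produces; this shape also makes its continuity immediate.\<close>
  define d where "d z = - (inverse (sqrt z) * (inverse (sqrt z) / 2) * inverse (sqrt z))" for z :: real
  have d: "((\<lambda>z. inverse (sqrt z)) has_real_derivative d z) (at z)" if "0 < z" for z
    unfolding d_def using that
    by (intro DERIV_inverse'[OF DERIV_real_sqrt]) auto
  show ?thesis
  proof (rule C1_on_orbitsI[where f'="\<lambda>x t. d (f (Xt t x)) * f' x t"])
    show "continuous_on S (\<lambda>y. inverse (sqrt (f y)))"
      using pos C1_on_orbits_continuous[OF assms(1)] by (intro continuous_intros) force+
    show "continuous_on {t. Xt t x \<in> S} (\<lambda>t. d (f (Xt t x)) * f' x t)" if "x \<in> S" for x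
      unfolding d_def using pos f'[OF that] by (intro continuous_intros) force+
    show "((\<lambda>s. inverse (sqrt (f (Xt s x)))) has_vector_derivative d (f (Xt t x)) * f' x t)
        (at t within {s. Xt s x \<in> S})" if "x \<in> S" "Xt t x \<in> S" for x t
      using DERIV_chain2[where f="\<lambda>z. inverse (sqrt z)" and g="\<lambda>s. f (Xt s x)" and x=t, OF d[OF pos[OF that(2)]]] f'(2)[OF that]
      by (simp flip: has_real_derivative_iff_has_vector_derivative)
  qed
qed

text \<open>\<open>Ck_on\<close> controls a derivative \<open>f' u w\<close> only for fixed
  \<open>w\<close>. Expanding a moving argument in the standard basis leaves finitely many fixed
  directions.\<close>

lemma linear_basis_expansion:
  fixes f :: "real^'n \<Rightarrow> 'b::real_vector"
  assumes "linear f"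
  shows "f v = (\<Sum>k\<in>UNIV. (v $ k) *\<^sub>R f (axis k 1))"
proof -
  have "f v = f (\<Sum>k\<in>UNIV. (v $ k) *\<^sub>R axis k 1)"
    using basis_expansion[of v] by (simp add: scalar_mult_eq_scaleR)
  also have "\<dots> = (\<Sum>k\<in>UNIV. (v $ k) *\<^sub>R f (axis k 1))"
    by (simp add: linear_sum[OF assms] linear_scale[OF assms])
  finally show ?thesis .
qed

lemma Ck_on_1_comp_has_vector_derivative:
  fixes F :: "real^'n \<Rightarrow> 'b::real_normed_vector"
  assumes F': "\<And>u. u \<in> S \<Longrightarrow> (F has_derivative F' u) (at u)"
    and "c t \<in> S" and "(c has_vector_derivative c') (at t within T)"
  shows "((\<lambda>s. F (c s)) has_vector_derivative (\<Sum>k\<in>UNIV. (c' $ k) *\<^sub>R F' (c t) (axis k 1))) (at t within T)"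
proof -
  have "((\<lambda>s. F (c s)) has_vector_derivative F' (c t) c') (at t within T)"
    using vector_derivative_diff_chain_within[OF assms(3) has_derivative_at_withinI[OF F'[OF assms(2)]]]
    by (simp add: o_def)
  then show ?thesis
    using linear_basis_expansion[OF has_derivative_linear[OF F'[OF assms(2)]], of c'] by simp
qed

lemma C1_on_orbits_comp:
  fixes F :: "real^'n \<Rightarrow> 'b::real_normed_vector"
  assumes F: "Ck_on 1 V F" and c: "continuous_on S c" "c ` S \<subseteq> V" and v: "continuous_on S v"
    and orbit: "\<And>x. x \<in> S \<Longrightarrow> continuous_on {t. Xt t x \<in> S} (\<lambda>t. Xt t x)"
    and ode: "\<And>x t. x \<in> S \<Longrightarrow> Xt t x \<in> S \<Longrightarrow>
      ((\<lambda>s. c (Xt s x)) has_vector_derivative v (Xt t x)) (at t within {s. Xt s x \<in> S})"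
  shows "C1_on_orbits Xt S (\<lambda>y. F (c y))"
proof -
  obtain F' where F': "\<And>u. u \<in> V \<Longrightarrow> (F has_derivative F' u) (at u)"
    and F'c: "\<And>w. continuous_on V (\<lambda>u. F' u w)"
    using F by auto
  have VF: "continuous_on V F"
    using F' has_derivative_continuous continuous_at_imp_continuous_on by blast
  \<comment> \<open>The derivative along an orbit is a function of the current point alone, so its
    continuity in \<open>t\<close> is inherited from the continuity of the orbit.\<close>
  define d where "d y = (\<Sum>k\<in>UNIV. (v y $ k) *\<^sub>R F' (c y) (axis k 1))" for y
  have d: "continuous_on S d" unfolding d_def
    by (intro continuous_intros v continuous_on_compose2[OF F'c c])
  show ?thesis
  proof (rule C1_on_orbitsI[where f'="\<lambda>x t. d (Xt t x)"])
    show "continuous_on S (\<lambda>y. F (c y))" by (rule continuous_on_compose2[OF VF c])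
    show "continuous_on {t. Xt t x \<in> S} (\<lambda>t. d (Xt t x))" if "x \<in> S" for x
      by (rule continuous_on_compose2[OF d orbit[OF that]]) auto
    show "((\<lambda>s. F (c (Xt s x))) has_vector_derivative d (Xt t x)) (at t within {s. Xt s x \<in> S})"
      if "x \<in> S" "Xt t x \<in> S" for x t
      unfolding d_def using c(2) that by (intro Ck_on_1_comp_has_vector_derivative[OF F' _ ode]) auto
  qed
qed


section \<open>First variation of a flow\<close>

text \<open>Turns continuity of a derivative in each fixed direction, as supplied by
  \<open>Ck_on\<close>, into an estimate of the operator norm.\<close>

lemma onorm_le_sum_Basis:
  fixes f :: "'a::euclidean_space \<Rightarrow> 'b::real_normed_vector"
  assumes "linear f"
  shows "onorm f \<le> (\<Sum>b\<in>Basis. norm (f b))"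
proof (rule onorm_le)
  fix x :: 'a
  have "f x = f (\<Sum>b\<in>Basis. (x \<bullet> b) *\<^sub>R b)" by (simp add: euclidean_representation)
  also have "\<dots> = (\<Sum>b\<in>Basis. (x \<bullet> b) *\<^sub>R f b)"
    by (simp add: linear_sum[OF assms] linear_scale[OF assms])
  also have "norm \<dots> \<le> (\<Sum>b\<in>Basis. norm (f b) * norm x)"
    by (rule sum_norm_le) (simp add: mult.commute[of "norm x"] mult.commute[of "\<bar>_\<bar>"] mult_left_mono Basis_le_norm)
  finally show "norm (f x) \<le> (\<Sum>b\<in>Basis. norm (f b)) * norm x" by (simp add: sum_distrib_right)
qed

text \<open>Strict differentiability of a \<open>C1\<close> map: the mean value inequality for
  \<open>F - F' u0\<close> makes the error small relative to \<open>a - b\<close> with both points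
  free. Two nearby orbits are to be compared, neither of which stays at \<open>u0\<close>.\<close>

lemma C1_linearization_bound:
  fixes F :: "'a::euclidean_space \<Rightarrow> 'b::real_normed_vector"
  assumes "open S" "u0 \<in> S" and F': "\<And>u. u \<in> S \<Longrightarrow> (F has_derivative F' u) (at u)"
    and F'c: "\<And>w. continuous_on S (\<lambda>u. F' u w)" and "0 < e"
  obtains r where "0 < r" "ball u0 r \<subseteq> S"
    "\<And>a b. a \<in> ball u0 r \<Longrightarrow> b \<in> ball u0 r \<Longrightarrow>
      norm (F a - F b - F' u0 (a - b)) \<le> e * norm (a - b)"
proof -
  define G where "G u = (\<Sum>b\<in>Basis. norm (F' u b - F' u0 b))" for u
  have "continuous_on S G" unfolding G_def by (intro continuous_intros F'c)
  then have "isCont G u0" using assms(1,2) continuous_on_eq_continuous_at by blast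
  moreover have "G u0 < e" using \<open>0 < e\<close> by (simp add: G_def)
  ultimately have "eventually (\<lambda>u. G u < e) (nhds u0)"
    by (metis isCont_def order_tendstoD(2) tendsto_at_iff_tendsto_nhds)
  moreover have "eventually (\<lambda>u. u \<in> S) (nhds u0)"
    using assms(1,2) eventually_nhds by blast
  ultimately have "eventually (\<lambda>u. G u < e \<and> u \<in> S) (nhds u0)" by eventually_elim simp
  then obtain r where r: "0 < r" "\<And>u. dist u u0 < r \<Longrightarrow> G u < e \<and> u \<in> S"
    unfolding eventually_nhds_metric by blast
  have sub: "ball u0 r \<subseteq> S" using r(2) by (auto simp: dist_commute)
  have lin0: "bounded_linear (F' u0)" using F'[OF assms(2)] has_derivative_bounded_linear by blast
  show ?thesis
  proof
    fix a b assume ab: "a \<in> ball u0 r" "b \<in> ball u0 r"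
    have "norm ((F a - F' u0 a) - (F b - F' u0 b)) \<le> e * norm (a - b)"
    proof (rule differentiable_bound[of "ball u0 r" _ "\<lambda>u w. F' u w - F' u0 w"])
      show "((\<lambda>x. F x - F' u0 x) has_derivative (\<lambda>w. F' x w - F' u0 w)) (at x within ball u0 r)"
        if "x \<in> ball u0 r" for x
        using sub that
        by (intro has_derivative_diff has_derivative_at_withinI[OF F']
            bounded_linear_imp_has_derivative lin0) auto
      show "onorm (\<lambda>w. F' x w - F' u0 w) \<le> e" if "x \<in> ball u0 r" for x
      proof -
        have "linear (\<lambda>w. F' x w - F' u0 w)"
          using sub that assms(2) by (intro linear_compose_sub has_derivative_linear[OF F']) auto
        then have "onorm (\<lambda>w. F' x w - F' u0 w) \<le> G x" unfolding G_def by (rule onorm_le_sum_Basis)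
        then show ?thesis using r(2)[of x] that by (force simp: dist_commute)
      qed
    qed (use ab in auto)
    then show "norm (F a - F b - F' u0 (a - b)) \<le> e * norm (a - b)"
      by (simp add: bounded_linear.linear[OF lin0, THEN linear_diff] algebra_simps)
  qed (use r sub in auto)
qed

text \<open>Only the increment in \<open>t\<close> from \<open>0\<close> matters,
  so the mean value inequality along one short orbit segment replaces Gronwall's inequality
  and the variational equation.\<close>

lemma flow_increment_bound:
  fixes \<gamma>\<^sub>1 \<gamma>\<^sub>2 :: "real \<Rightarrow> 'a::real_normed_vector"
  assumes "0 \<in> T" "convex T" "compact T" and T: "\<And>s. s \<in> T \<Longrightarrow> \<bar>s\<bar> \<le> \<tau>"
    and ode: "\<And>s. s \<in> T \<Longrightarrow> (\<gamma>\<^sub>1 has_vector_derivative F (\<gamma>\<^sub>1 s)) (at s within T)"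
      "\<And>s. s \<in> T \<Longrightarrow> (\<gamma>\<^sub>2 has_vector_derivative F (\<gamma>\<^sub>2 s)) (at s within T)"
    and L: "bounded_linear L" and K: "\<And>w. norm (L w) \<le> K * norm w" "0 \<le> K"
    and lin: "\<And>s. s \<in> T \<Longrightarrow>
      norm (F (\<gamma>\<^sub>1 s) - F (\<gamma>\<^sub>2 s) - L (\<gamma>\<^sub>1 s - \<gamma>\<^sub>2 s)) \<le> e * norm (\<gamma>\<^sub>1 s - \<gamma>\<^sub>2 s)"
    and e: "0 \<le> e" and small: "(K + e) * \<tau> \<le> 1/2" and t: "t \<in> T"
  defines "w \<equiv> \<gamma>\<^sub>1 0 - \<gamma>\<^sub>2 0"
  shows "norm (\<gamma>\<^sub>1 t - \<gamma>\<^sub>2 t - w - t *\<^sub>R L w) \<le> (2 * e + 2 * K * (K + e) * \<tau>) * norm w * \<bar>t\<bar>"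
proof -
  define \<Delta> where "\<Delta> s = \<gamma>\<^sub>1 s - \<gamma>\<^sub>2 s" for s
  have M0: "0 \<le> K + e" using K e by simp
  have d: "(\<Delta> has_vector_derivative F (\<gamma>\<^sub>1 s) - F (\<gamma>\<^sub>2 s)) (at s within T)" if "s \<in> T" for s
    unfolding \<Delta>_def using that by (intro has_vector_derivative_diff ode)
  have F12: "norm (F (\<gamma>\<^sub>1 s) - F (\<gamma>\<^sub>2 s)) \<le> (K + e) * norm (\<Delta> s)" if "s \<in> T" for s
  proof -
    have "norm (F (\<gamma>\<^sub>1 s) - F (\<gamma>\<^sub>2 s)) \<le> norm (F (\<gamma>\<^sub>1 s) - F (\<gamma>\<^sub>2 s) - L (\<Delta> s)) + norm (L (\<Delta> s))"
      using norm_triangle_ineq[of "F (\<gamma>\<^sub>1 s) - F (\<gamma>\<^sub>2 s) - L (\<Delta> s)" "L (\<Delta> s)"] by simp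
    also have "\<dots> \<le> e * norm (\<Delta> s) + K * norm (\<Delta> s)"
      using lin[OF that] K(1)[of "\<Delta> s"] by (simp add: \<Delta>_def)
    finally show ?thesis by (simp add: algebra_simps)
  qed
  have mvt: "norm (f s - f 0) \<le> C * \<bar>s\<bar>"
    if "\<And>s. s \<in> T \<Longrightarrow> (f has_vector_derivative f' s) (at s within T)"
      "\<And>s. s \<in> T \<Longrightarrow> norm (f' s) \<le> C" "s \<in> T" for f :: "real \<Rightarrow> 'a" and f' C s
  proof -
    have "norm (f s - f 0) \<le> C * norm (s - 0)"
    proof (rule differentiable_bound[OF \<open>convex T\<close>])
      show "(f has_derivative (\<lambda>h. h *\<^sub>R f' x)) (at x within T)" if "x \<in> T" for x
        using \<open>\<And>s. s \<in> T \<Longrightarrow> (f has_vector_derivative f' s) (at s within T)\<close>[OF that]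
        by (simp add: has_vector_derivative_def)
      show "onorm (\<lambda>h. h *\<^sub>R f' x) \<le> C" if "x \<in> T" for x
        using \<open>\<And>s. s \<in> T \<Longrightarrow> norm (f' s) \<le> C\<close>[OF that]
        by (intro onorm_le) (simp add: mult.commute[of C] mult_left_mono)
    qed (use \<open>0 \<in> T\<close> that in auto)
    then show ?thesis by simp
  qed
  have "continuous_on T \<Delta>"
    unfolding continuous_on_eq_continuous_within using d has_vector_derivative_continuous by blast
  \<comment> \<open>\<open>s0\<close> is a time of greatest separation of the two orbits. By
    \<open>small\<close>, the separation there is at most \<open>norm w\<close> plus half of itself,
    which is where the factor 2 comes from.\<close>
  then obtain s0 where s0: "s0 \<in> T" "\<And>s. s \<in> T \<Longrightarrow> norm (\<Delta> s) \<le> norm (\<Delta> s0)"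
    using continuous_attains_sup[OF \<open>compact T\<close>, of "\<lambda>s. norm (\<Delta> s)"] \<open>0 \<in> T\<close>
    by (auto intro: continuous_on_norm)
  have \<Delta>w: "norm (\<Delta> s - w) \<le> (K + e) * norm (\<Delta> s0) * \<bar>s\<bar>" if "s \<in> T" for s
    using mvt[OF d, of "(K + e) * norm (\<Delta> s0)" s] that
      order_trans[OF F12 mult_left_mono[OF s0(2) M0]]
    by (simp add: w_def \<Delta>_def)
  have "norm (\<Delta> s0) \<le> norm w + norm (\<Delta> s0 - w)"
    using norm_triangle_ineq[of w "\<Delta> s0 - w"] by simp
  also have "norm (\<Delta> s0 - w) \<le> ((K + e) * \<tau>) * norm (\<Delta> s0)"
    using \<Delta>w[OF s0(1)] mult_left_mono[OF T[OF s0(1)], of "(K + e) * norm (\<Delta> s0)"] M0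
    by (simp add: mult_ac)
  also have "\<dots> \<le> 1/2 * norm (\<Delta> s0)" by (intro mult_right_mono small) auto
  finally have m: "norm (\<Delta> s0) \<le> 2 * norm w" by simp
  \<comment> \<open>With the expected increment \<open>s *\<^sub>R L w\<close> removed, the
    derivative is pure error: \<open>e\<close> times the separation from linearising
    \<open>F\<close>, and \<open>K\<close> times the drift of the separation away from
    \<open>w\<close>.\<close>
  define \<psi> where "\<psi> s = \<Delta> s - s *\<^sub>R L w" for s
  have "norm (\<psi> t - \<psi> 0) \<le> ((2 * e + 2 * K * (K + e) * \<tau>) * norm w) * \<bar>t\<bar>"
  proof (rule mvt[OF _ _ t])
    fix s assume s: "s \<in> T"
    show "(\<psi> has_vector_derivative (F (\<gamma>\<^sub>1 s) - F (\<gamma>\<^sub>2 s)) - L w) (at s within T)"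
      unfolding \<psi>_def by (auto intro!: derivative_eq_intros d[OF s])
    have "norm (F (\<gamma>\<^sub>1 s) - F (\<gamma>\<^sub>2 s) - L w) =
        norm ((F (\<gamma>\<^sub>1 s) - F (\<gamma>\<^sub>2 s) - L (\<Delta> s)) + L (\<Delta> s - w))"
      by (simp add: linear_diff[OF bounded_linear.linear[OF L]])
    also have "\<dots> \<le> e * norm (\<Delta> s) + K * norm (\<Delta> s - w)"
      using lin[OF s] K(1)[of "\<Delta> s - w"] by (intro norm_triangle_le) (simp add: \<Delta>_def)
    also have "\<dots> \<le> e * (2 * norm w) + K * ((K + e) * (2 * norm w) * \<tau>)"
    proof (intro add_mono mult_left_mono e K(2))
      show "norm (\<Delta> s) \<le> 2 * norm w" using s0(2)[OF s] m by simp
      have "norm (\<Delta> s - w) \<le> (K + e) * norm (\<Delta> s0) * \<bar>s\<bar>" by (rule \<Delta>w[OF s])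
      also have "\<dots> \<le> (K + e) * (2 * norm w) * \<tau>"
        by (intro mult_mono m T s mult_left_mono M0) (use M0 in auto)
      finally show "norm (\<Delta> s - w) \<le> (K + e) * (2 * norm w) * \<tau>" .
    qed
    finally show "norm (F (\<gamma>\<^sub>1 s) - F (\<gamma>\<^sub>2 s) - L w) \<le> (2 * e + 2 * K * (K + e) * \<tau>) * norm w"
      by (simp add: algebra_simps)
  qed
  then show ?thesis by (simp add: \<psi>_def \<Delta>_def w_def algebra_simps)
qed

text \<open>The increment bound concerns two orbits at finite distance, while the cocycle is a
  derivative in the initial point. A Lipschitz bound along the line through \<open>x\<close> in
  direction \<open>w\<close> passes to the derivative there.\<close>

lemma directional_derivative_norm_bound:
  fixes f :: "'a::real_normed_vector \<Rightarrow> 'b::real_normed_vector"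
  assumes f: "(f has_derivative f') (at x)" and "0 < \<delta>"
    and bound: "\<And>h. \<bar>h\<bar> < \<delta> \<Longrightarrow> norm (f (x + h *\<^sub>R w) - f x) \<le> C * \<bar>h\<bar>"
  shows "norm (f' w) \<le> C"
proof -
  have "((\<lambda>h. f (x + h *\<^sub>R w)) has_vector_derivative f' w) (at 0)"
  proof -
    have "((\<lambda>h. x + h *\<^sub>R w) has_vector_derivative w) (at 0)"
      by (auto intro!: derivative_eq_intros)
    then show ?thesis
      using vector_derivative_diff_chain_within[of "\<lambda>h. x + h *\<^sub>R w" w 0 UNIV f f'] f
      by (simp add: o_def has_derivative_at_withinI)
  qed
  then have d: "\<exists>d>0. \<forall>h. \<bar>h\<bar> < d \<longrightarrow> norm (f (x + h *\<^sub>R w) - f x - h *\<^sub>R f' w) \<le> e * \<bar>h\<bar>"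
    if "0 < e" for e
    using that by (simp add: has_vector_derivative_def has_derivative_at_alt)
  show ?thesis
  proof (rule field_le_epsilon)
    fix e :: real assume "0 < e"
    then obtain d where "0 < d" and d: "\<And>h. \<bar>h\<bar> < d \<Longrightarrow> norm (f (x + h *\<^sub>R w) - f x - h *\<^sub>R f' w) \<le> e * \<bar>h\<bar>"
      using d by blast
    define h where "h = min d \<delta> / 2"
    have h: "0 < h" "\<bar>h\<bar> < d" "\<bar>h\<bar> < \<delta>" using \<open>0 < d\<close> \<open>0 < \<delta>\<close> by (auto simp: h_def)
    have "h * norm (f' w) = norm ((f (x + h *\<^sub>R w) - f x) - (f (x + h *\<^sub>R w) - f x - h *\<^sub>R f' w))"
      using h by simp
    also have "\<dots> \<le> C * \<bar>h\<bar> + e * \<bar>h\<bar>"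
      using bound[OF h(3)] d[OF h(2)] by (rule norm_triangle_le_diff[OF add_mono])
    finally have "h * norm (f' w) \<le> h * (C + e)" using h by (simp add: algebra_simps)
    then show "norm (f' w) \<le> C + e" using h by simp
  qed
qed

text \<open>The error of the increment between the orbits of \<open>u0 + h w\<close> and
  \<open>u0\<close> is at most \<open>\<epsilon> * \<bar>t\<bar> * \<bar>h\<bar>\<close>, uniformly
  for small \<open>h\<close>. Letting \<open>h\<close> tend to 0 at fixed \<open>t\<close> leaves
  the estimate for \<open>D t w\<close>. The hypotheses are local at \<open>(0, u0)\<close> because
  orbits may leave the chart.\<close>

lemma flow_derivative_has_vector_derivative_0:
  fixes \<phi> :: "real \<Rightarrow> 'a::euclidean_space \<Rightarrow> 'a"
  assumes "open S" "u0 \<in> S" and F': "\<And>u. u \<in> S \<Longrightarrow> (F has_derivative F' u) (at u)"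
    and F'c: "\<And>w. continuous_on S (\<lambda>u. F' u w)"
    and cont: "((\<lambda>(t, u). \<phi> t u) \<longlongrightarrow> u0) (nhds (0, u0))"
    and ev: "eventually (\<lambda>(t, u). \<phi> 0 u = u \<and>
      (\<phi> t u \<in> S \<longrightarrow> ((\<lambda>s. \<phi> s u) has_vector_derivative F (\<phi> t u)) (at t))) (nhds (0, u0))"
    and D: "eventually (\<lambda>t. (\<phi> t has_derivative D t) (at u0)) (nhds 0)"
  shows "((\<lambda>t. D t w) has_vector_derivative F' u0 w) (at 0)"
proof -
  have L: "bounded_linear (F' u0)" using F'[OF assms(2)] has_derivative_bounded_linear by blast
  define K where "K = onorm (F' u0)"
  have K: "norm (F' u0 w) \<le> K * norm w" "0 \<le> K" for w
    unfolding K_def using L onorm onorm_pos_le by blast+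
  have key: "\<exists>d>0. \<forall>t. \<bar>t\<bar> < d \<longrightarrow> norm (D t w - w - t *\<^sub>R F' u0 w) \<le> \<epsilon> * \<bar>t\<bar>" if \<epsilon>: "0 < \<epsilon>" for \<epsilon>
  proof -
    \<comment> \<open>The factor 4 absorbs two error terms of size \<open>2 * e\<close> each; adding
      1 to \<open>norm w\<close> avoids dividing by zero.\<close>
    define e where "e = \<epsilon> / (4 * (norm w + 1))"
    have e: "0 < e" using \<epsilon> by (simp add: e_def add_nonneg_pos)
    obtain r where r: "0 < r" "ball u0 r \<subseteq> S"
      "\<And>a b. a \<in> ball u0 r \<Longrightarrow> b \<in> ball u0 r \<Longrightarrow>
        norm (F a - F b - F' u0 (a - b)) \<le> e * norm (a - b)"
      using C1_linearization_bound[OF assms(1,2) F' F'c e] by metis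
    have "eventually (\<lambda>p. dist (case p of (t, u) \<Rightarrow> \<phi> t u) u0 < r) (nhds (0, u0))"
      by (rule tendstoD[OF cont r(1)])
    with ev have "eventually (\<lambda>(t, u). \<phi> t u \<in> ball u0 r \<and> \<phi> 0 u = u \<and>
      ((\<lambda>s. \<phi> s u) has_vector_derivative F (\<phi> t u)) (at t)) (nhds (0, u0))"
      by (rule eventually_elim2) (use r(2) in \<open>auto simp: dist_commute\<close>)
    then obtain P Q where P: "eventually P (nhds 0)" and Q: "eventually Q (nhds u0)"
      and PQ: "\<And>t u. P t \<Longrightarrow> Q u \<Longrightarrow> \<phi> t u \<in> ball u0 r \<and> \<phi> 0 u = u \<and>
      ((\<lambda>s. \<phi> s u) has_vector_derivative F (\<phi> t u)) (at t)"
      unfolding nhds_prod eventually_prod_filter by auto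
    obtain \<delta>1 where \<delta>1: "0 < \<delta>1" "\<And>t. \<bar>t\<bar> < \<delta>1 \<Longrightarrow> P t \<and> (\<phi> t has_derivative D t) (at u0)"
      using eventually_conj[OF P D] unfolding eventually_nhds_metric by (auto simp: dist_real_def)
    obtain \<delta>2 where \<delta>2: "0 < \<delta>2" "\<And>u. dist u u0 < \<delta>2 \<Longrightarrow> Q u"
      using Q unfolding eventually_nhds_metric by blast
    \<comment> \<open>The three bounds on \<open>t\<close> keep the orbits in the region under
      control, make \<open>(K + e) * \<bar>t\<bar>\<close> at most 1/2, and make the drift term
      \<open>2 * K * (K + e) * \<bar>t\<bar>\<close> at most \<open>2 * e\<close>.\<close>
    define d where "d = min \<delta>1 (min (1 / (2 * (K + e))) (e / (K * (K + e) + 1)))"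
    have Ke: "0 < K + e" "0 < K * (K + e) + 1" using K(2) e by (auto intro: add_nonneg_pos)
    have d: "0 < d" using \<delta>1 Ke e by (simp add: d_def)
    have "norm (D t w - w - t *\<^sub>R F' u0 w) \<le> \<epsilon> * \<bar>t\<bar>" if t: "\<bar>t\<bar> < d" for t
    proof -
      define \<delta> where "\<delta> = \<delta>2 / (norm w + 1)"
      have \<delta>: "0 < \<delta>" using \<delta>2 by (simp add: \<delta>_def add_nonneg_pos)
      define f where "f u = \<phi> t u - u - t *\<^sub>R F' u0 u" for u
      have Dt: "(\<phi> t has_derivative D t) (at u0)" using \<delta>1(2) t by (simp add: d_def)
      have "norm ((\<lambda>w. D t w - w - t *\<^sub>R F' u0 w) w) \<le> \<epsilon> * \<bar>t\<bar>"
      proof (rule directional_derivative_norm_bound[where f=f and f'="\<lambda>w. D t w - w - t *\<^sub>R F' u0 w", OF _ \<delta>])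
        show "(f has_derivative (\<lambda>w. D t w - w - t *\<^sub>R F' u0 w)) (at u0)"
          unfolding f_def
          by (intro derivative_intros Dt bounded_linear_imp_has_derivative L)
        fix h :: real assume h: "\<bar>h\<bar> < \<delta>"
        define u where "u = u0 + h *\<^sub>R w"
        have "\<bar>h\<bar> * norm w \<le> \<bar>h\<bar> * (norm w + 1)" by (simp add: mult_left_mono)
        also have "\<dots> < \<delta>2" using h pos_less_divide_eq[of "norm w + 1" "\<bar>h\<bar>" \<delta>2] by (simp add: \<delta>_def add_nonneg_pos)
        finally have Qu: "Q u" "Q u0" using \<delta>2 by (auto simp: u_def dist_norm)
        \<comment> \<open>A symmetric interval covers positive and negative \<open>t\<close>
          together.\<close>
        let ?T = "cball 0 \<bar>t\<bar> :: real set"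
        have T: "P s" if "s \<in> ?T" for s using that t \<delta>1 by (auto simp: d_def)
        have tK: "(K + e) * \<bar>t\<bar> \<le> 1/2" "K * (K + e) * \<bar>t\<bar> \<le> e"
        proof -
          have "\<bar>t\<bar> \<le> 1 / (2 * (K + e))" "\<bar>t\<bar> \<le> e / (K * (K + e) + 1)" using t by (auto simp: d_def)
          then have "(K + e) * \<bar>t\<bar> \<le> 1/2" "(K * (K + e) + 1) * \<bar>t\<bar> \<le> e"
            using Ke by (auto simp: field_simps)
          then show "(K + e) * \<bar>t\<bar> \<le> 1/2" "K * (K + e) * \<bar>t\<bar> \<le> e"
            by (auto simp: distrib_right)
        qed
        have "norm (\<phi> t u - \<phi> t u0 - (\<phi> 0 u - \<phi> 0 u0) - t *\<^sub>R F' u0 (\<phi> 0 u - \<phi> 0 u0))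
          \<le> (2 * e + 2 * K * (K + e) * \<bar>t\<bar>) * norm (\<phi> 0 u - \<phi> 0 u0) * \<bar>t\<bar>"
          by (rule flow_increment_bound[where T="?T" and F=F])
            (use PQ[OF T Qu(1)] PQ[OF T Qu(2)] L K e tK r(3) in
              \<open>auto intro: has_vector_derivative_at_within\<close>)
        also have "\<phi> 0 u - \<phi> 0 u0 = h *\<^sub>R w"
          using PQ[OF T Qu(1), of 0] PQ[OF T Qu(2), of 0] by (simp add: u_def)
        also have "(2 * e + 2 * K * (K + e) * \<bar>t\<bar>) * norm (h *\<^sub>R w) * \<bar>t\<bar> \<le>
            (4 * e) * (\<bar>h\<bar> * (norm w + 1)) * \<bar>t\<bar>"
          by (intro mult_right_mono mult_mono) (use e tK in \<open>auto simp: mult_left_mono\<close>)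
        also have "\<dots> = \<epsilon> * \<bar>t\<bar> * \<bar>h\<bar>"
        proof -
          have "4 * e * (norm w + 1) = \<epsilon>"
          proof -
            have "4 * (\<epsilon> / (4 * m)) * m = \<epsilon>" if "m \<noteq> 0" for m using that by simp
            then show ?thesis using norm_ge_zero[of w] unfolding e_def by (smt (verit))
          qed
          then show ?thesis by (metis (no_types, lifting) mult.assoc mult.commute)
        qed
        also have "\<phi> t u - \<phi> t u0 - h *\<^sub>R w - t *\<^sub>R F' u0 (h *\<^sub>R w) = f u - f u0"
          by (simp add: f_def u_def linear_add[OF bounded_linear.linear[OF L]] algebra_simps)
        finally show "norm (f (u0 + h *\<^sub>R w) - f u0) \<le> \<epsilon> * \<bar>t\<bar> * \<bar>h\<bar>" by (simp add: u_def)
      qed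
      then show ?thesis by simp
    qed
    with d show ?thesis by blast
  qed
  have D0: "D 0 w = w"
  proof -
    obtain d where "0 < d" "\<forall>t. \<bar>t\<bar> < d \<longrightarrow> norm (D t w - w - t *\<^sub>R F' u0 w) \<le> 1 * \<bar>t\<bar>"
      using key[of 1] by auto
    then have "norm (D 0 w - w - 0 *\<^sub>R F' u0 w) \<le> 1 * \<bar>0\<bar>" by (metis abs_zero)
    then show ?thesis by simp
  qed
  show ?thesis
    unfolding has_vector_derivative_def has_derivative_at_alt
  proof (intro conjI allI impI)
    show "bounded_linear (\<lambda>x. x *\<^sub>R F' u0 w)" by (rule bounded_linear_scaleR_left)
    fix \<epsilon> :: real assume "0 < \<epsilon>"
    then show "\<exists>d>0. \<forall>y. norm (y - 0) < d \<longrightarrow>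
        norm (D y w - D 0 w - (y - 0) *\<^sub>R F' u0 w) \<le> \<epsilon> * norm (y - 0)"
      using key[of \<epsilon>] by (simp add: D0)
  qed
qed


section \<open>Charts and tangent spaces\<close>

lemma isCont_tendsto_nhds: "isCont f a \<Longrightarrow> (f \<longlongrightarrow> f a) (nhds a)"
  by (simp add: isCont_def tendsto_at_iff_tendsto_nhds)

section \<open>Forms and their index pulled back to coordinates\<close>

lemma polar_eq_bilinear:
  assumes "sym_bilinear_on S B" "\<And>v. v \<in> S \<Longrightarrow> Q v = B v v" "subspace S" "u \<in> S" "v \<in> S"
  shows "polar Q u v = B u v"
proof -
  have uv: "u + v \<in> S" using assms by (simp add: subspace_add)
  have add: "B (a + b) c = B a c + B b c" if "a \<in> S" "b \<in> S" "c \<in> S" for a b c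
    using assms(1) that by (simp add: sym_bilinear_on_def)
  have sym: "B a b = B b a" if "a \<in> S" "b \<in> S" for a b
    using assms(1) that by (simp add: sym_bilinear_on_def)
  have "B (u + v) (u + v) = B u u + B v v + 2 * B u v"
    using add[OF assms(4,5) uv] add[OF assms(4,5) assms(4)] add[OF assms(4,5) assms(5)]
      sym[OF assms(4) uv] sym[OF assms(5) uv] sym[OF assms(4,5)] by simp
  then show ?thesis using assms uv by (simp add: polar_def)
qed

lemma sym_bilinear_on_imp_bilinear:
  assumes "sym_bilinear_on S B" "linear f" "range f \<subseteq> S"
  shows "bilinear (\<lambda>u v. B (f u) (f v))" "B (f u) (f v) = B (f v) (f u)"
proof -
  have f: "f u \<in> S" for u using assms(3) by auto
  have sym: "B (f u) (f v) = B (f v) (f u)" for u v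
    using assms(1) f by (simp add: sym_bilinear_on_def)
  have "linear (\<lambda>u. B (f u) (f v))" for v
    using assms(1) f
    by (intro linearI) (simp_all add: sym_bilinear_on_def linear_add[OF assms(2)] linear_scale[OF assms(2)])
  then show "bilinear (\<lambda>u v. B (f u) (f v))" unfolding bilinear_def using sym by simp
  show "B (f u) (f v) = B (f v) (f u)" by (rule sym)
qed

text \<open>The index of a form counts dimensions inside the space of all functions on charts; this
  compares them with dimensions in \<open>real^'n\<close>.\<close>

lemma dim_injective_image:
  fixes f :: "'a::euclidean_space \<Rightarrow> 'b::real_vector"
  assumes f: "linear f" and "inj f"
  shows "dim (f ` V) = dim V"
proof -
  obtain B where B: "B \<subseteq> V" "independent B" "V \<subseteq> span B" "card B = dim V" using basis_exists by blast
  have inj: "inj_on f X" for X using \<open>inj f\<close> by (rule inj_on_subset) simp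
  have "span B = span V" using B span_mono[of B V] span_minimal[of V "span B"] by auto
  then have "span (f ` B) = span (f ` V)" by (simp add: linear_span_image[OF f])
  moreover have "independent (f ` B)" using linear_independent_injective_image[OF f B(2) inj] .
  ultimately have "dim (f ` V) = card (f ` B)" by (rule dim_eq_card)
  then show ?thesis using B(4) card_image[OF inj] by simp
qed

text \<open>Images and preimages match the non-positive subspaces of the domain with those of the
  range, and injectivity preserves their dimensions.\<close>

lemma has_index_on_pullback:
  fixes f :: "'a::euclidean_space \<Rightarrow> 'b::real_vector"
  assumes f: "linear f" "inj f" and "has_index_on (range f) Q q"
  shows "has_index_on UNIV (\<lambda>u. Q (f u)) q"
  unfolding has_index_on_def
proof (intro conjI allI impI)
  obtain V where V: "subspace V" "V \<subseteq> range f" "\<forall>v\<in>V. Q v \<le> 0" "dim V = q"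
    using assms(3) by (auto simp: has_index_on_def)
  have im: "f ` (f -` V) = V" using V(2) by auto
  show "\<exists>W. subspace W \<and> W \<subseteq> UNIV \<and> (\<forall>v\<in>W. Q (f v) \<le> 0) \<and> dim W = q"
  proof (intro exI conjI)
    show "subspace (f -` V)" using linear_subspace_vimage[OF f(1) V(1)] .
    show "dim (f -` V) = q" using dim_injective_image[OF f, of "f -` V"] im V(4) by simp
  qed (use V in auto)
next
  fix W :: "'a set" assume W: "subspace W \<and> W \<subseteq> UNIV \<and> (\<forall>v\<in>W. Q (f v) \<le> 0)"
  then have "subspace (f ` W)" using linear_subspace_image[OF f(1)] by blast
  then have "dim (f ` W) \<le> q" using assms(3) W by (auto simp: has_index_on_def)
  then show "dim W \<le> q" by (simp add: dim_injective_image[OF f])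
qed

abbreviation transition_derivative ::
  "('m, 'n::finite) chart \<Rightarrow> ('m, 'n) chart \<Rightarrow> 'm \<Rightarrow> real^'n \<Rightarrow> real^'n" where
  "transition_derivative c d x \<equiv> frechet_derivative (transition c d) (at (snd c x))"

locale atlas =
  fixes A :: "('m::t2_space, 'n::finite) chart set"
  assumes smooth: "smooth_atlas A"
begin

lemma chart_open: "c \<in> A \<Longrightarrow> open (fst c)"
  and chart_image_open: "c \<in> A \<Longrightarrow> open (snd c ` fst c)"
  and chart_homeomorphism: "c \<in> A \<Longrightarrow> homeomorphism (fst c) (snd c ` fst c) (snd c) (chart_inv c)"
  using smooth by (auto simp: smooth_atlas_def)

lemma chart_continuous: "c \<in> A \<Longrightarrow> continuous_on (fst c) (snd c)"
  and chart_inv_continuous: "c \<in> A \<Longrightarrow> continuous_on (snd c ` fst c) (chart_inv c)"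
  and chart_inv_snd: "c \<in> A \<Longrightarrow> x \<in> fst c \<Longrightarrow> chart_inv c (snd c x) = x"
  using chart_homeomorphism by (auto simp: homeomorphism_def)

lemma chart_at:
  obtains c where "c \<in> A" "x \<in> fst c"
proof -
  have "x \<in> (\<Union>c\<in>A. fst c)" using smooth by (simp add: smooth_atlas_def)
  then show ?thesis using that by blast
qed

lemma overlap_open:
  assumes "c \<in> A" "d \<in> A"
  shows "open (snd c ` (fst c \<inter> fst d))"
proof -
  have "snd c ` (fst c \<inter> fst d) = snd c ` fst c \<inter> chart_inv c -` fst d"
    using chart_inv_snd[OF assms(1)] by auto
  then show ?thesis
    using continuous_open_preimage[OF chart_inv_continuous chart_image_open chart_open] assms by metis
qed

lemma transition_snd: "c \<in> A \<Longrightarrow> x \<in> fst c \<Longrightarrow> transition c d (snd c x) = snd d x"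
  by (simp add: transition_def chart_inv_snd)

lemma transition_Ck:
  "c \<in> A \<Longrightarrow> d \<in> A \<Longrightarrow> Ck_on k (snd c ` (fst c \<inter> fst d)) (transition c d)"
  using smooth by (simp add: smooth_atlas_def)

lemma transition_has_derivative:
  assumes "c \<in> A" "d \<in> A" "x \<in> fst c" "x \<in> fst d"
  shows "(transition c d has_derivative transition_derivative c d x) (at (snd c x))"
proof -
  obtain f' where "\<forall>u\<in>snd c ` (fst c \<inter> fst d). (transition c d has_derivative f' u) (at u)"
    using transition_Ck[OF assms(1,2), of 1] by auto
  then have "(transition c d has_derivative f' (snd c x)) (at (snd c x))" using assms by auto
  then show ?thesis using frechet_derivative_at by metis
qed

lemma transition_derivative_linear:
  assumes "c \<in> A" "d \<in> A" "x \<in> fst c" "x \<in> fst d"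
  shows "linear (transition_derivative c d x)"
  using has_derivative_linear[OF transition_has_derivative[OF assms]] .

lemma transition_derivative_self:
  assumes "c \<in> A" "x \<in> fst c"
  shows "transition_derivative c c x w = w"
proof -
  have "(transition c c has_derivative (\<lambda>w. w)) (at (snd c x))"
    by (rule has_derivative_transform_within_open[OF has_derivative_ident chart_image_open[OF assms(1)]])
      (use assms in \<open>auto simp: transition_snd\<close>)
  then show ?thesis using frechet_derivative_at by metis
qed

text \<open>The chain rule for chart changes, which makes the family built by \<open>tvec\<close>
  consistent across charts.\<close>

lemma transition_derivative_comp:
  assumes "c \<in> A" "d \<in> A" "e \<in> A" "x \<in> fst c" "x \<in> fst d" "x \<in> fst e"
  shows "transition_derivative d e x (transition_derivative c d x w) = transition_derivative c e x w"
proof -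
  have "(transition d e \<circ> transition c d has_derivative
      transition_derivative d e x \<circ> transition_derivative c d x) (at (snd c x))"
    by (intro diff_chain_at transition_has_derivative)
      (use assms transition_has_derivative[of d e x] in \<open>simp_all add: transition_snd\<close>)
  then have "(transition c e has_derivative
      transition_derivative d e x \<circ> transition_derivative c d x) (at (snd c x))"
    by (rule has_derivative_transform_within_open[OF _ overlap_open[OF assms(1,2)]])
      (use assms in \<open>auto simp: transition_snd\<close>)
  then show ?thesis using frechet_derivative_at by (metis comp_apply)
qed

lemma tvec_in_tangent_space:
  assumes "c \<in> A" "x \<in> fst c"
  shows "tvec A c x w \<in> tangent_space A x"
  using assms by (auto simp: tangent_space_def tvec_def transition_derivative_comp)

lemma tvec_chart: "c \<in> A \<Longrightarrow> x \<in> fst c \<Longrightarrow> tvec A c x w c = w"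
  by (simp add: tvec_def transition_derivative_self)

lemma tvec_of_tangent:
  assumes "c \<in> A" "x \<in> fst c" "v \<in> tangent_space A x"
  shows "tvec A c x (v c) = v"
proof
  fix d
  show "tvec A c x (v c) d = v d"
  proof (cases "d \<in> A \<and> x \<in> fst d")
    case True
    then have "v d = transition_derivative c d x (v c)"
      using assms unfolding tangent_space_def by blast
    with True show ?thesis by (simp add: tvec_def)
  next
    case False
    then have "v d = 0" using assms unfolding tangent_space_def by blast
    with False show ?thesis by (auto simp: tvec_def)
  qed
qed

lemma linear_tvec:
  assumes "c \<in> A" "x \<in> fst c"
  shows "linear (tvec A c x)"
proof (rule linearI)
  show "tvec A c x (u + v) = tvec A c x u + tvec A c x v" for u v
    using assms by (auto simp: tvec_def fun_eq_iff linear_add[OF transition_derivative_linear])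
  show "tvec A c x (r *\<^sub>R v) = r *\<^sub>R tvec A c x v" for r v
    using assms by (auto simp: tvec_def fun_eq_iff scaleR_fun_def linear_scale[OF transition_derivative_linear])
qed

lemma inj_tvec: "c \<in> A \<Longrightarrow> x \<in> fst c \<Longrightarrow> inj (tvec A c x)"
  by (metis injI tvec_chart)

text \<open>With linearity and injectivity this identifies the tangent space with
  \<open>real^'n\<close>, so that pointwise linear algebra can be done in one chart.\<close>

lemma range_tvec:
  assumes "c \<in> A" "x \<in> fst c"
  shows "range (tvec A c x) = tangent_space A x"
  using tvec_in_tangent_space[OF assms] tvec_of_tangent[OF assms] by (metis image_subsetI rangeI subsetI subset_antisym)

lemma subspace_tangent_space: "subspace (tangent_space A x)"
  using chart_at linear_subspace_image[OF linear_tvec subspace_UNIV] range_tvec by metis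

lemma tangent_eqI:
  assumes "c \<in> A" "x \<in> fst c" "v \<in> tangent_space A x" "w \<in> tangent_space A x" "v c = w c"
  shows "v = w"
  using tvec_of_tangent assms by metis

end


section \<open>The flow and the form in a chart\<close>

locale flow_setting = atlas A
  for A :: "('m::t2_space, 'n::finite) chart set" +
  fixes X :: "'m \<Rightarrow> ('m, 'n) tangent"
    and Xt :: "real \<Rightarrow> 'm \<Rightarrow> 'm"
    and DX :: "real \<Rightarrow> 'm \<Rightarrow> ('m, 'n) tangent \<Rightarrow> ('m, 'n) tangent"
    and U :: "'m set"
    and J :: "'m \<Rightarrow> ('m, 'n) tangent \<Rightarrow> real"
    and q :: nat and I :: "'n set"
  assumes C1X: "C1_vector_field A X" and flow: "flow_of A X Xt"
    and cocycle: "derivative_cocycle A Xt DX"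
    and forward: "\<forall>t>0. Xt t ` U \<subseteq> U"
    and J_field: "nondegenerate_field A Xt U J q"
begin

lemma Xt_0: "Xt 0 x = x"
  using flow by (simp add: flow_of_def)

lemma Xt_continuous: "continuous_on UNIV (\<lambda>(t, x). Xt t x)"
  using flow by (simp add: flow_of_def)

lemma orbit_continuous: "continuous_on T (\<lambda>t. Xt t x)"
proof -
  have "continuous_on UNIV (\<lambda>t. case (t, x) of (t, x) \<Rightarrow> Xt t x)"
    by (rule continuous_on_compose2[OF Xt_continuous]) (auto intro: continuous_intros)
  then show ?thesis using continuous_on_subset by auto
qed

lemma orbit_open: "open W \<Longrightarrow> open {t. Xt t x \<in> W}"
  using open_vimage[OF _ orbit_continuous[of UNIV x], of W] by (simp add: vimage_def)

lemma orbit_ode: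
  "c \<in> A \<Longrightarrow> Xt t x \<in> fst c \<Longrightarrow> ((\<lambda>s. snd c (Xt s x)) has_vector_derivative X (Xt t x) c) (at t within T)"
  using flow by (auto simp: flow_of_def intro: has_vector_derivative_at_within)

lemma X_tangent: "X x \<in> tangent_space A x"
  using C1X by (simp add: C1_vector_field_def)

lemma X_continuous:
  assumes "c \<in> A"
  shows "continuous_on (fst c) (\<lambda>y. X y c)"
proof -
  have "Ck_on 1 (snd c ` fst c) (\<lambda>u. X (chart_inv c u) c)"
    using C1X assms by (simp add: C1_vector_field_def)
  then obtain f' where "\<And>u. u \<in> snd c ` fst c \<Longrightarrow> ((\<lambda>u. X (chart_inv c u) c) has_derivative f' u) (at u)"
    by auto
  then have "continuous_on (snd c ` fst c) (\<lambda>u. X (chart_inv c u) c)"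
    by (intro continuous_at_imp_continuous_on ballI has_derivative_continuous)
  then have "continuous_on (fst c) (\<lambda>y. X (chart_inv c (snd c y)) c)"
    by (rule continuous_on_compose2[OF _ chart_continuous[OF assms]]) auto
  then show ?thesis using chart_inv_snd[OF assms] by (simp cong: continuous_on_cong)
qed

lemma C1_on_orbits_chart:
  fixes F :: "real^'n \<Rightarrow> 'b::real_normed_vector"
  assumes "c \<in> A" "S \<subseteq> fst c" "Ck_on 1 V F" "snd c ` S \<subseteq> V"
  shows "C1_on_orbits Xt S (\<lambda>y. F (snd c y))"
  using assms
  by (intro C1_on_orbits_comp[of V F S "snd c" "\<lambda>y. X y c"] orbit_continuous orbit_ode
      continuous_on_subset[OF chart_continuous] continuous_on_subset[OF X_continuous]) auto

lemma C1_on_orbits_X: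
  assumes "c \<in> A" "S \<subseteq> fst c"
  shows "C1_on_orbits Xt S (\<lambda>y. X y c)"
proof (rule C1_on_orbits_cong)
  show "C1_on_orbits Xt S (\<lambda>y. X (chart_inv c (snd c y)) c)"
    by (rule C1_on_orbits_chart[OF assms, of "snd c ` fst c" "\<lambda>u. X (chart_inv c u) c"])
      (use C1X assms in \<open>auto simp only: C1_vector_field_def\<close>)
qed (use assms chart_inv_snd[OF assms(1)] in auto)

text \<open>Frames are constructed in a single chart \<open>c\<close>, but their regularity is
  required in every chart \<open>d\<close>.\<close>

lemma C1_on_orbits_tvec:
  assumes "c \<in> A" "d \<in> A" "S \<subseteq> fst c" and f: "C1_on_orbits Xt S f"
  shows "C1_on_orbits Xt (S \<inter> fst d) (\<lambda>y. tvec A c y (f y) d)"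
proof -
  let ?V = "snd c ` (fst c \<inter> fst d)"
  have V: "snd c ` (S \<inter> fst d) \<subseteq> ?V" using assms(3) by auto
  \<comment> \<open>Two orders of smoothness are taken: the coordinates in \<open>d\<close> contain
    the derivative of the chart change, which must itself be \<open>C1\<close>.\<close>
  have "Ck_on (Suc 1) ?V (transition c d)" using transition_Ck[OF assms(1,2)] .
  then obtain f' where f': "\<And>u. u \<in> ?V \<Longrightarrow> (transition c d has_derivative f' u) (at u)"
    "\<And>w. Ck_on 1 ?V (\<lambda>u. f' u w)" unfolding Ck_on.simps(2)[of 1] by metis
  have eq: "transition_derivative c d y = f' (snd c y)" if "y \<in> S \<inter> fst d" for y
    using frechet_derivative_at[OF f'(1)] V that by (metis image_subset_iff)
  have "C1_on_orbits Xt (S \<inter> fst d) (\<lambda>y. \<Sum>k\<in>UNIV. (f y $ k) *\<^sub>R f' (snd c y) (axis k 1))"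
    by (intro C1_on_orbits_sum C1_on_orbits_scaleR C1_on_orbits_nth C1_on_orbits_subset[OF f]
        C1_on_orbits_chart[OF assms(1) _ f'(2) V]) (use assms(3) in auto)
  then show ?thesis
  proof (rule C1_on_orbits_cong)
    fix y assume y: "y \<in> S \<inter> fst d"
    show "tvec A c y (f y) d = (\<Sum>k\<in>UNIV. (f y $ k) *\<^sub>R f' (snd c y) (axis k 1))"
      using linear_basis_expansion[OF transition_derivative_linear[OF assms(1,2), of y], of "f y"]
        eq[OF y] y assms by (auto simp: tvec_def)
  qed
qed

section \<open>The polar form in the coordinates of a chart\<close>

definition chart_form :: "('m, 'n) chart \<Rightarrow> 'm \<Rightarrow> real^'n \<Rightarrow> real^'n \<Rightarrow> real" where
  "chart_form c y u v = polar (J y) (tvec A c y u) (tvec A c y v)"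

context
  fixes c y assumes c: "c \<in> A" and y: "y \<in> fst c" and yU: "y \<in> U"
begin

lemma
  shows bilinear_chart_form: "bilinear (chart_form c y)"
    and chart_form_sym: "chart_form c y u v = chart_form c y v u"
    and chart_form_diag: "chart_form c y u u = J y (tvec A c y u)"
proof -
  obtain B where B: "sym_bilinear_on (tangent_space A y) B" "\<And>v. v \<in> tangent_space A y \<Longrightarrow> J y v = B v v"
    using J_field yU unfolding nondegenerate_field_def quadratic_form_on_def by metis
  have eq: "chart_form c y = (\<lambda>u v. B (tvec A c y u) (tvec A c y v))"
    unfolding chart_form_def
    using polar_eq_bilinear[OF B subspace_tangent_space] tvec_in_tangent_space[OF c y]
    by (intro ext) simp
  show "bilinear (chart_form c y)" "chart_form c y u v = chart_form c y v u"
    unfolding eq using sym_bilinear_on_imp_bilinear[OF B(1) linear_tvec[OF c y]] range_tvec[OF c y] by auto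
  show "chart_form c y u u = J y (tvec A c y u)"
    unfolding eq using B(2) tvec_in_tangent_space[OF c y] by simp
qed

lemma chart_form_nondegenerate:
  assumes "\<And>v. chart_form c y u v = 0"
  shows "u = 0"
proof -
  have "nondegenerate_on (tangent_space A y) (J y)" using J_field yU by (simp add: nondegenerate_field_def)
  moreover have "polar (J y) (tvec A c y u) w = 0" if "w \<in> tangent_space A y" for w
    using assms[of "w c"] tvec_of_tangent[OF c y that] by (simp add: chart_form_def)
  ultimately have "tvec A c y u = 0"
    using tvec_in_tangent_space[OF c y] by (simp add: nondegenerate_on_def)
  then show ?thesis using tvec_chart[OF c y, of u] by simp
qed

lemma chart_form_index: "has_index_on UNIV (\<lambda>u. chart_form c y u u) q"
  unfolding chart_form_diag
  using J_field yU range_tvec[OF c y]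
  by (intro has_index_on_pullback[where f="tvec A c y" and Q="J y"] linear_tvec inj_tvec c y)
    (simp add: nondegenerate_field_def)

lemma chart_form_expansion:
  "chart_form c y u v = (\<Sum>k\<in>UNIV. (u $ k) * (\<Sum>l\<in>UNIV. (v $ l) * chart_form c y (axis k 1) (axis l 1)))"
  using linear_basis_expansion[OF bilinear_linears(1)[OF bilinear_chart_form, of v], of u]
    linear_basis_expansion[OF bilinear_linears(2)[OF bilinear_chart_form], of _ v] by simp

end

text \<open>Regularity of \<open>J\<close> is given for vectors with constant coordinates.
  Polarisation extends it to pairs of constant vectors, and expansion in the standard basis to
  arguments that vary with the point.\<close>

lemma C1_on_orbits_chart_form:
  assumes c: "c \<in> A" and S: "S \<subseteq> U \<inter> fst c" and f: "C1_on_orbits Xt S f" and g: "C1_on_orbits Xt S g"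
  shows "C1_on_orbits Xt S (\<lambda>y. chart_form c y (f y) (g y))"
proof -
  have Q: "C1_on_orbits Xt S (\<lambda>y. J y (tvec A c y w))" for w
    using J_field c S
    by (intro C1_on_orbits_subset[OF _ S]) (simp add: nondegenerate_field_def C1_on_orbits_def)
  have const: "C1_on_orbits Xt S (\<lambda>y. chart_form c y u v)" for u v
  proof (rule C1_on_orbits_cong)
    show "C1_on_orbits Xt S (\<lambda>y. (J y (tvec A c y (u + v)) - J y (tvec A c y u) - J y (tvec A c y v)) * (1/2))"
      by (intro C1_on_orbits_mult C1_on_orbits_diff Q C1_on_orbits_const)
    show "chart_form c y u v = (J y (tvec A c y (u + v)) - J y (tvec A c y u) - J y (tvec A c y v)) * (1/2)"
      if "y \<in> S" for y
      using that S by (auto simp: chart_form_def polar_def linear_add[OF linear_tvec[OF c]])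
  qed
  have "C1_on_orbits Xt S (\<lambda>y. \<Sum>k\<in>UNIV. (f y $ k) *
      (\<Sum>l\<in>UNIV. (g y $ l) * chart_form c y (axis k 1) (axis l 1)))"
    by (intro C1_on_orbits_sum C1_on_orbits_mult C1_on_orbits_nth f g const)
  then show ?thesis
    by (rule C1_on_orbits_cong) (use chart_form_expansion[OF c] S in blast)
qed

section \<open>The derivative cocycle at a point and at time 0\<close>

lemma DX_tangent: "v \<in> tangent_space A x \<Longrightarrow> DX t x v \<in> tangent_space A (Xt t x)"
  using cocycle by (simp add: derivative_cocycle_def)

lemma DX_has_derivative:
  "c \<in> A \<Longrightarrow> d \<in> A \<Longrightarrow> x \<in> fst c \<Longrightarrow> Xt t x \<in> fst d \<Longrightarrow>
    ((\<lambda>u. snd d (Xt t (chart_inv c u))) has_derivative (\<lambda>w. DX t x (tvec A c x w) d)) (at (snd c x))"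
  using cocycle by (simp add: derivative_cocycle_def)

text \<open>Linearity is visible in a chart around the target point, and a tangent vector there is
  determined by its coordinates in that one chart.\<close>

lemma linear_DX: "linear (\<lambda>w. DX t x (tvec A c x w))" if c: "c \<in> A" "x \<in> fst c"
proof -
  obtain d where d: "d \<in> A" "Xt t x \<in> fst d" by (rule chart_at)
  have lin: "linear (\<lambda>w. DX t x (tvec A c x w) d)"
    using has_derivative_linear[OF DX_has_derivative[OF c(1) d(1) c(2) d(2)]] .
  have "(\<lambda>w. DX t x (tvec A c x w)) = tvec A d (Xt t x) \<circ> (\<lambda>w. DX t x (tvec A c x w) d)"
    using tvec_of_tangent[OF d DX_tangent[OF tvec_in_tangent_space[OF c]]] by auto
  then show ?thesis using linear_compose[OF lin linear_tvec[OF d]] by simp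
qed

lemma DX_0: "v \<in> tangent_space A x \<Longrightarrow> DX 0 x v = v"
proof -
  assume v: "v \<in> tangent_space A x"
  obtain c where c: "c \<in> A" "x \<in> fst c" by (rule chart_at)
  have "((\<lambda>u. snd c (Xt 0 (chart_inv c u))) has_derivative (\<lambda>w. DX 0 x (tvec A c x w) c)) (at (snd c x))"
    by (rule DX_has_derivative) (use c in \<open>simp_all add: Xt_0\<close>)
  moreover have "((\<lambda>u. snd c (Xt 0 (chart_inv c u))) has_derivative (\<lambda>w. w)) (at (snd c x))"
    by (rule has_derivative_transform_within_open[OF has_derivative_ident chart_image_open[OF c(1)]])
      (use c in \<open>auto simp: Xt_0 chart_inv_snd\<close>)
  ultimately have "DX 0 x (tvec A c x w) c = w" for w
    using has_derivative_unique by metis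
  then have "DX 0 x v c = v c" using tvec_of_tangent[OF c v] by metis
  then show ?thesis using tangent_eqI[OF c _ v] DX_tangent[OF v, of 0] Xt_0 by simp
qed

text \<open>The first variation is applied to the flow read in the chart. Joint continuity of the
  flow keeps short orbits of nearby points inside the chart, which gives the local hypotheses near
  \<open>(0, snd c x)\<close>.\<close>

lemma DX_has_vector_derivative_0:
  assumes c: "c \<in> A" "x \<in> fst c" and v: "v \<in> tangent_space A x"
  obtains D where "((\<lambda>t. DX t x v c) has_vector_derivative D) (at 0)"
proof -
  let ?S = "snd c ` fst c" and ?\<phi> = "\<lambda>t u. snd c (Xt t (chart_inv c u))"
  have "Ck_on 1 ?S (\<lambda>u. X (chart_inv c u) c)"
    using C1X c by (simp add: C1_vector_field_def)
  then obtain F' where F': "\<And>u. u \<in> ?S \<Longrightarrow> ((\<lambda>u. X (chart_inv c u) c) has_derivative F' u) (at u)"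
    "\<And>w. continuous_on ?S (\<lambda>u. F' u w)" by auto
  have inv: "continuous (at (snd c x)) (chart_inv c)"
    using chart_inv_continuous[OF c(1)] chart_image_open[OF c(1)] c continuous_on_eq_continuous_at by blast
  have tX: "((\<lambda>(t, u). Xt t (chart_inv c u)) \<longlongrightarrow> x) (nhds (0, snd c x))"
  proof -
    have "isCont (\<lambda>(t, x). Xt t x) (0, x)"
      using Xt_continuous continuous_on_eq_continuous_at by blast
    moreover have "isCont (\<lambda>p. (fst p, chart_inv c (snd p))) (0, snd c x)"
      by (intro continuous_intros continuous_at_compose[of _ snd, unfolded o_def]) (simp add: inv)
    ultimately have "isCont (\<lambda>p. (\<lambda>(t, x). Xt t x) (fst p, chart_inv c (snd p))) (0, snd c x)"
      by (intro isCont_o2[where f="\<lambda>p. (fst p, chart_inv c (snd p))" and g="\<lambda>(t, x). Xt t x"])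
        (simp_all add: chart_inv_snd[OF c])
    then show ?thesis
      using isCont_tendsto_nhds by (fastforce simp: chart_inv_snd[OF c] Xt_0 split_def)
  qed
  have evX: "eventually (\<lambda>(t, u). Xt t (chart_inv c u) \<in> fst c) (nhds (0, snd c x))"
    using topological_tendstoD[OF tX chart_open[OF c(1)] c(2)] by (simp add: split_def)
  have "isCont (snd c) x"
    using chart_continuous chart_open c continuous_on_eq_continuous_at by blast
  then have t\<phi>: "((\<lambda>(t, u). ?\<phi> t u) \<longlongrightarrow> snd c x) (nhds (0, snd c x))"
    using isCont_tendsto_compose[OF _ tX, of "snd c"] by (simp add: split_def)
  have evS: "eventually (\<lambda>p. snd p \<in> ?S) (nhds (0::real, snd c x))"
    by (rule topological_tendstoD[OF _ chart_image_open[OF c(1)]])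
      (use c in \<open>auto intro: tendsto_snd filterlim_ident\<close>)
  have "((\<lambda>t. DX t x (tvec A c x (v c)) c) has_vector_derivative F' (snd c x) (v c)) (at 0)"
  proof (rule flow_derivative_has_vector_derivative_0[OF chart_image_open[OF c(1)] _ F' t\<phi>])
    show "snd c x \<in> ?S" using c by simp
    show "eventually (\<lambda>(t, u). ?\<phi> 0 u = u \<and> (?\<phi> t u \<in> ?S \<longrightarrow>
        ((\<lambda>s. ?\<phi> s u) has_vector_derivative X (chart_inv c (?\<phi> t u)) c) (at t))) (nhds (0, snd c x))"
    proof (rule eventually_elim2[OF evX evS], goal_cases)
      case (1 p)
      obtain t u where p: "p = (t, u)" by fastforce
      have "snd c (chart_inv c u) = u" using 1(2) c by (auto simp: p chart_inv_snd)
      moreover have "((\<lambda>s. ?\<phi> s u) has_vector_derivative X (chart_inv c (?\<phi> t u)) c) (at t)"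
        using 1(1) orbit_ode[OF c(1), of t "chart_inv c u" UNIV] by (simp add: p chart_inv_snd c)
      ultimately show ?case by (simp add: p Xt_0)
    qed
    have "((\<lambda>t. Xt t x) \<longlongrightarrow> x) (nhds 0)"
      using isCont_tendsto_nhds[of 0 "\<lambda>t. Xt t x"] orbit_continuous[of UNIV x]
      by (simp add: Xt_0 continuous_on_eq_continuous_at)
    then have "eventually (\<lambda>t. Xt t x \<in> fst c) (nhds 0)"
      using topological_tendstoD chart_open c by blast
    then show "eventually (\<lambda>t. (?\<phi> t has_derivative (\<lambda>w. DX t x (tvec A c x w) c)) (at (snd c x))) (nhds 0)"
      by eventually_elim (use DX_has_derivative c in blast)
  qed
  then show ?thesis using that tvec_of_tangent[OF c v] by simp
qed


section \<open>Existence of adapted frames\<close>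

text \<open>If \<open>J p (X p)\<close> were 0, the polar form would vanish on the whole line of
  \<open>X p\<close>, against its non-degeneracy there. Positivity permits division by the square
  root of \<open>J p (X p)\<close>.\<close>

lemma J_X_pos:
  assumes p: "p \<in> U" "X p \<noteq> 0" "0 \<le> J p (X p)" "nondegenerate_on (span {X p}) (J p)"
  shows "0 < J p (X p)"
proof (rule ccontr)
  assume "\<not> 0 < J p (X p)"
  then have 0: "J p (X p) = 0" using p(3) by simp
  obtain c where c: "c \<in> A" "p \<in> fst c" by (rule chart_at)
  let ?B = "chart_form c p" and ?u = "X p c"
  have X: "r *\<^sub>R X p = tvec A c p (r *\<^sub>R ?u)" for r
    using tvec_of_tangent[OF c X_tangent] by (simp add: linear_scale[OF linear_tvec[OF c]])
  have B0: "?B ?u ?u = 0" using 0 X[of 1] by (simp add: chart_form_diag[OF c p(1)])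
  have "polar (J p) (X p) w = 0" if w: "w \<in> span {X p}" for w
  proof -
    obtain r where "w = r *\<^sub>R X p" using w by (auto simp: span_singleton)
    then have "polar (J p) (X p) w = ?B ?u (r *\<^sub>R ?u)" using X[of r] X[of 1] by (simp add: chart_form_def)
    then show ?thesis using B0 by (simp add: bilinear_rmul[OF bilinear_chart_form[OF c p(1)]])
  qed
  then show False using p(2,4) by (auto simp: nondegenerate_on_def span_base)
qed

text \<open>Continuity is only relative to \<open>U\<close>, which need not be open, so positivity
  spreads to the points of \<open>U\<close> in an open set.\<close>

lemma positive_near:
  assumes "C1_on_orbits Xt (W \<inter> U) f" "open W" "p \<in> W" "p \<in> U" "0 < (f p :: real)"
  obtains W' where "open W'" "p \<in> W'" "W' \<subseteq> W" "\<And>y. y \<in> W' \<inter> U \<Longrightarrow> 0 < f y"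
proof -
  have "openin (top_of_set (W \<inter> U)) (W \<inter> U \<inter> f -` {0<..})"
    using continuous_openin_preimage_gen[OF C1_on_orbits_continuous[OF assms(1)]] by simp
  then obtain V where V: "open V" "W \<inter> U \<inter> f -` {0<..} = W \<inter> U \<inter> V" by (auto simp: openin_open)
  show ?thesis
    by (rule that[of "W \<inter> V"]) (use V assms in auto)
qed

text \<open>The invariant of the Gram-Schmidt induction over the index set \<open>K\<close>. The
  values \<open>e i p = b i\<close> are carried along because they make the next residual at
  \<open>p\<close> equal to \<open>b k\<close>, hence non-isotropic near \<open>p\<close>.\<close>

definition partial_frame ::
  "('m, 'n) chart \<Rightarrow> 'm \<Rightarrow> ('n \<Rightarrow> real^'n) \<Rightarrow> ('n \<Rightarrow> real) \<Rightarrow> 'n \<Rightarrow> 'n set \<Rightarrow>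
    'm set \<Rightarrow> ('n \<Rightarrow> 'm \<Rightarrow> real^'n) \<Rightarrow> bool" where
  "partial_frame c p b s j K W e \<longleftrightarrow> open W \<and> p \<in> W \<and> W \<subseteq> fst c \<and>
    (\<forall>i\<in>K. C1_on_orbits Xt (W \<inter> U) (e i) \<and> e i p = b i) \<and>
    (\<forall>y\<in>W \<inter> U. (\<forall>i\<in>K. \<forall>k\<in>K. chart_form c y (e i y) (e k y) = (if i = k then s i else 0)) \<and>
      (\<exists>r. e j y = r *\<^sub>R X y c))"

text \<open>Gram-Schmidt for the indefinite form, started at the direction of \<open>X\<close>. The vectors \<open>b i\<close>,
  constant in the chart \<open>c\<close>, are already pseudo-orthonormal at \<open>p\<close>, so no vector
  to be normalised becomes isotropic near \<open>p\<close>.\<close>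

lemma gram_schmidt_near:
  fixes s :: "'n \<Rightarrow> real"
  assumes c: "c \<in> A" "p \<in> fst c" and p: "p \<in> U" and pos: "0 < J p (X p)"
    and b: "\<And>i k. chart_form c p (b i) (b k) = (if i = k then s i else 0)"
    and bj: "b j = inverse (sqrt (J p (X p))) *\<^sub>R X p c" and s: "s j = 1" "\<And>i. s i * s i = 1"
    and "finite K"
  shows "\<exists>W e. partial_frame c p b s j (insert j K) W e"
  using \<open>finite K\<close>
proof induction
  case empty
  let ?f = "\<lambda>y. chart_form c y (X y c) (X y c)"
  have f: "C1_on_orbits Xt (fst c \<inter> U) ?f"
    by (intro C1_on_orbits_chart_form C1_on_orbits_X c) auto
  have "0 < ?f p" using pos by (simp add: chart_form_diag c p tvec_of_tangent X_tangent)
  then obtain W where W: "open W" "p \<in> W" "W \<subseteq> fst c" "\<And>y. y \<in> W \<inter> U \<Longrightarrow> 0 < ?f y"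
    using positive_near[OF f chart_open[OF c(1)] c(2) p] by metis
  define e where "e i y = inverse (sqrt (?f y)) *\<^sub>R X y c" for i :: 'n and y
  have "C1_on_orbits Xt (W \<inter> U) (e j)"
    unfolding e_def using W
    by (intro C1_on_orbits_scaleR C1_on_orbits_inverse_sqrt C1_on_orbits_X C1_on_orbits_subset[OF f] c) auto
  moreover have "e j p = b j"
    using bj by (simp add: e_def chart_form_diag c p tvec_of_tangent X_tangent)
  moreover have "chart_form c y (e j y) (e j y) = 1" if "y \<in> W \<inter> U" for y
  proof -
    have y: "y \<in> fst c" "y \<in> U" using that W by auto
    show ?thesis
      using W(4)[OF that]
      by (simp add: e_def bilinear_lmul[OF bilinear_chart_form[OF c(1) y]]
        bilinear_rmul[OF bilinear_chart_form[OF c(1) y]] field_simps)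
  qed
  moreover have "\<exists>r. e j y = r *\<^sub>R X y c" for y by (auto simp: e_def)
  ultimately show ?case
    using W s(1) by (intro exI[of _ W] exI[of _ e]) (simp add: partial_frame_def)
next
  case (insert k K)
  let ?K = "insert j K"
  obtain W e where "partial_frame c p b s j ?K W e" using insert.IH by blast
  then have W: "open W" "p \<in> W" "W \<subseteq> fst c"
    and C1: "\<And>i. i \<in> ?K \<Longrightarrow> C1_on_orbits Xt (W \<inter> U) (e i)"
    and ep: "\<And>i. i \<in> ?K \<Longrightarrow> e i p = b i"
    and orth: "\<And>y i k. y \<in> W \<inter> U \<Longrightarrow> i \<in> ?K \<Longrightarrow> k \<in> ?K \<Longrightarrow>
      chart_form c y (e i y) (e k y) = (if i = k then s i else 0)"
    and ej: "\<And>y. y \<in> W \<inter> U \<Longrightarrow> \<exists>r. e j y = r *\<^sub>R X y c"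
    unfolding partial_frame_def by blast+
  show ?case
  proof (cases "k = j")
    case True
    then show ?thesis using insert.IH by simp
  next
    case False
    then have k: "k \<notin> ?K" using insert.hyps by simp
    define f where "f y = b k - (\<Sum>i\<in>?K. (s i * chart_form c y (b k) (e i y)) *\<^sub>R e i y)" for y
    \<comment> \<open>The factor \<open>s k\<close> makes \<open>h p\<close> equal to 1 whichever
      sign the new vector has, so \<open>h\<close> stays positive near \<open>p\<close> and its
      square root can be used for normalising.\<close>
    define h where "h y = s k * chart_form c y (f y) (f y)" for y
    have WU: "W \<inter> U \<subseteq> U \<inter> fst c" using W by auto
    have fC1: "C1_on_orbits Xt (W \<inter> U) f" unfolding f_def
      by (intro C1_on_orbits_diff C1_on_orbits_sum C1_on_orbits_scaleR C1_on_orbits_mult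
          C1_on_orbits_chart_form[OF c(1) WU] C1_on_orbits_const C1)
    have hC1: "C1_on_orbits Xt (W \<inter> U) h" unfolding h_def
      by (intro C1_on_orbits_mult C1_on_orbits_chart_form[OF c(1) WU] C1_on_orbits_const fC1)
    have "chart_form c p (b k) (e i p) = 0" if "i \<in> ?K" for i
      using b[of k i] that k ep[OF that] by auto
    then have fp: "f p = b k" by (simp add: f_def)
    have "h p = 1" using b[of k k] s(2) by (simp add: h_def fp)
    then have hp: "0 < h p" by simp
    obtain W' where W': "open W'" "p \<in> W'" "W' \<subseteq> W" "\<And>y. y \<in> W' \<inter> U \<Longrightarrow> 0 < h y"
      using positive_near[OF hC1 W(1,2) p hp] by blast
    define ek where "ek y = inverse (sqrt (h y)) *\<^sub>R f y" for y
    let ?e = "e(k := ek)"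
    have sub: "W' \<inter> U \<subseteq> W \<inter> U" using W' by auto
    have ekC1: "C1_on_orbits Xt (W' \<inter> U) ek" unfolding ek_def
      by (intro C1_on_orbits_scaleR C1_on_orbits_inverse_sqrt C1_on_orbits_subset[OF fC1 sub]
          C1_on_orbits_subset[OF hC1 sub] W'(4))
    have ekp: "ek p = b k" using \<open>h p = 1\<close> fp by (simp add: ek_def)
    have ek: "chart_form c y (ek y) (ek y) = s k" "\<And>i. i \<in> ?K \<Longrightarrow> chart_form c y (ek y) (e i y) = 0"
      "\<And>i. i \<in> ?K \<Longrightarrow> chart_form c y (e i y) (ek y) = 0"
      if "y \<in> W' \<inter> U" for y
    proof -
      have y: "y \<in> fst c" "y \<in> U" "y \<in> W \<inter> U" using that W W' by auto
      note bil = bilinear_chart_form[OF c(1) y(1,2)]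
      have "inverse (sqrt (h y)) * inverse (sqrt (h y)) = inverse (h y)"
        using W'(4)[OF that] by (simp flip: inverse_mult_distrib)
      moreover have "chart_form c y (f y) (f y) = s k * h y"
        using s(2)[of k] by (simp add: h_def flip: mult.assoc)
      ultimately show "chart_form c y (ek y) (ek y) = s k"
        using W'(4)[OF that]
        by (simp add: ek_def bilinear_lmul[OF bil] bilinear_rmul[OF bil] flip: mult.assoc)
      show *: "chart_form c y (ek y) (e i y) = 0" if i: "i \<in> ?K" for i
      proof -
        have "chart_form c y (\<Sum>i\<in>?K. (s i * chart_form c y (b k) (e i y)) *\<^sub>R e i y) (e i y) =
            (s i * chart_form c y (b k) (e i y)) * s i"
          by (rule pseudo_orthonormal_coords[of "chart_form c y" ?K "\<lambda>i. e i y" s])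
            (use bilinear_linears[OF bil] insert.hyps orth[OF y(3)] i in simp_all)
        also have "\<dots> = chart_form c y (b k) (e i y)"
          using s(2)[of i] by (metis mult.assoc mult.commute mult.right_neutral)
        finally show ?thesis
          by (simp add: ek_def f_def bilinear_lmul[OF bil] bilinear_lsub[OF bil])
      qed
      then show "chart_form c y (e i y) (ek y) = 0" if "i \<in> ?K" for i
        using that chart_form_sym[OF c(1) y(1,2)] by metis
    qed
    have "insert j (insert k K) = insert k ?K" by auto
    moreover have "\<forall>i\<in>insert k ?K. C1_on_orbits Xt (W' \<inter> U) (?e i) \<and> ?e i p = b i"
      using ekC1 ekp ep C1_on_orbits_subset[OF C1 sub] by simp
    moreover have "\<forall>y\<in>W' \<inter> U. (\<forall>i\<in>insert k ?K. \<forall>l\<in>insert k ?K.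
        chart_form c y (?e i y) (?e l y) = (if i = l then s i else 0)) \<and> (\<exists>r. ?e j y = r *\<^sub>R X y c)"
    proof (intro ballI conjI)
      fix y i l assume y: "y \<in> W' \<inter> U" and "i \<in> insert k ?K" "l \<in> insert k ?K"
      moreover have "y \<in> W \<inter> U" using y sub by auto
      ultimately show "chart_form c y (?e i y) (?e l y) = (if i = l then s i else 0)"
        using ek[OF y] orth k by auto
    next
      fix y assume "y \<in> W' \<inter> U"
      then show "\<exists>r. ?e j y = r *\<^sub>R X y c" using ej sub False by auto
    qed
    ultimately show ?thesis
      using W W' by (intro exI[of _ W'] exI[of _ ?e]) (auto simp add: partial_frame_def simp del: fun_upd_apply)
  qed
qed

text \<open>Linear algebra at the single point \<open>p\<close>, where the index fixes the number of
  negative vectors, is enough: Gram-Schmidt preserves the signs \<open>s i\<close> at nearby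
  points.\<close>

lemma adapted_frame_exists:
  assumes p: "p \<in> U" "X p \<noteq> 0" "0 \<le> J p (X p)" "nondegenerate_on (span {X p}) (J p)"
    and I: "card I = q" and j: "j \<notin> I"
  shows "\<exists>e. adapted_frame_near A Xt J U I p e \<and> (\<exists>W. open W \<and> p \<in> W \<and> (\<forall>y\<in>W \<inter> U. e j y \<in> span {X y}))"
proof -
  obtain c where c: "c \<in> A" "p \<in> fst c" by (rule chart_at)
  define s where "s i = (if i \<in> I then -1 else 1 :: real)" for i
  have pos: "0 < J p (X p)" using J_X_pos[OF p] .
  define b0 where "b0 = inverse (sqrt (J p (X p))) *\<^sub>R X p c"
  note bil = bilinear_chart_form[OF c p(1)]
  have "chart_form c p b0 b0 = 1"
    using pos by (simp add: b0_def bilinear_lmul[OF bil] bilinear_rmul[OF bil]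
      chart_form_diag c p(1) tvec_of_tangent X_tangent field_simps)
  then obtain b where b: "b j = b0"
    "\<And>i k. chart_form c p (b i) (b k) = (if i = k then (if i \<in> I then -1 else 1) else 0)"
    using signed_basis_exists[OF bil chart_form_sym[OF c p(1)] chart_form_nondegenerate[OF c p(1)]
        _ chart_form_index[OF c p(1)] I j] by metis
  have "\<exists>W e. partial_frame c p b s j (insert j UNIV) W e"
    by (rule gram_schmidt_near[OF c p(1) pos]) (use b j in \<open>auto simp: s_def b0_def\<close>)
  then obtain W e where "partial_frame c p b s j UNIV W e" by auto
  then have W: "open W" "p \<in> W" "W \<subseteq> fst c"
    and C1: "\<And>i. C1_on_orbits Xt (W \<inter> U) (e i)"
    and orth: "\<And>y i k. y \<in> W \<inter> U \<Longrightarrow> chart_form c y (e i y) (e k y) = (if i = k then s i else 0)"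
    and ej: "\<And>y. y \<in> W \<inter> U \<Longrightarrow> \<exists>r. e j y = r *\<^sub>R X y c"
    unfolding partial_frame_def by blast+
  define E where "E i y = tvec A c y (e i y)" for i y
  have "adapted_frame_near A Xt J U I p E"
    unfolding adapted_frame_near_def
  proof (intro exI[of _ W] conjI ballI allI W(1,2))
    fix y assume "y \<in> W \<inter> U"
    then have y: "y \<in> fst c" "y \<in> U" "y \<in> W \<inter> U" using W by auto
    note bil = bilinear_chart_form[OF c(1) y(1,2)] and lin = linear_tvec[OF c(1) y(1)]
      and inj = inj_tvec[OF c(1) y(1)]
    have ind: "inj (\<lambda>i. e i y)" "independent (range (\<lambda>i. e i y))"
      using pseudo_orthonormal_imp_independent[of "chart_form c y" UNIV "\<lambda>i. e i y" s]
        bilinear_linears[OF bil] orth[OF y(3)] by (auto simp: s_def)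
    have "UNIV \<subseteq> span (range (\<lambda>i. e i y))"
      by (rule card_ge_dim_independent) (use ind in \<open>auto simp: card_image\<close>)
    then have sp: "span (range (\<lambda>i. e i y)) = UNIV" by auto
    have rE: "range (\<lambda>i. E i y) = tvec A c y ` range (\<lambda>i. e i y)" by (auto simp: E_def)
    show "inj (\<lambda>i. E i y)"
      using ind(1) inj by (auto simp: E_def inj_def)
    show "independent (range (\<lambda>i. E i y))"
      unfolding rE by (rule linear_independent_injective_image[OF lin ind(2)]) (use inj in \<open>auto intro: inj_on_subset\<close>)
    show "span (range (\<lambda>i. E i y)) = tangent_space A y"
      unfolding rE linear_span_image[OF lin] sp by (rule range_tvec[OF c(1) y(1)])
    fix \<alpha> :: "real^'n"
    have "frame_comb E y \<alpha> = tvec A c y (\<Sum>i\<in>UNIV. (\<alpha> $ i) *\<^sub>R e i y)"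
      by (simp add: frame_comb_def E_def linear_sum[OF lin] linear_scale[OF lin])
    then have "J y (frame_comb E y \<alpha>) = (\<Sum>i\<in>UNIV. s i * (\<alpha> $ i)\<^sup>2)"
      using pseudo_orthonormal_diag[OF bil, of UNIV "\<lambda>i. e i y" s "\<lambda>i. \<alpha> $ i"] orth[OF y(3)]
      by (simp add: chart_form_diag[OF c(1) y(1,2)])
    also have "\<dots> = (\<Sum>i\<in>I. s i * (\<alpha> $ i)\<^sup>2) + (\<Sum>i\<in>-I. s i * (\<alpha> $ i)\<^sup>2)"
      using sum.union_disjoint[of I "-I" "\<lambda>i. s i * (\<alpha> $ i)\<^sup>2"] by simp
    also have "\<dots> = - (\<Sum>i\<in>I. (\<alpha> $ i)\<^sup>2) + (\<Sum>i\<in>-I. (\<alpha> $ i)\<^sup>2)"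
      by (simp add: s_def sum_negf)
    finally show "J y (frame_comb E y \<alpha>) = - (\<Sum>i\<in>I. (\<alpha> $ i)\<^sup>2) + (\<Sum>i\<in>-I. (\<alpha> $ i)\<^sup>2)" .
  next
    fix i d assume d: "d \<in> A"
    have "C1_on_orbits Xt (W \<inter> U \<inter> fst d) (\<lambda>y. E i y d)"
      unfolding E_def by (rule C1_on_orbits_tvec[OF c(1) d _ C1]) (use W in auto)
    then show "continuous_on (W \<inter> U \<inter> fst d) (\<lambda>y. E i y d)"
      "C1_along_flow_on Xt (W \<inter> U \<inter> fst d) (\<lambda>y. E i y d)"
      by (simp_all add: C1_on_orbits_def)
  qed
  moreover have "E j y \<in> span {X y}" if "y \<in> W \<inter> U" for y
  proof -
    have y: "y \<in> fst c" using that W by auto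
    obtain r where "e j y = r *\<^sub>R X y c" using ej[OF \<open>y \<in> W \<inter> U\<close>] by blast
    then have "E j y = r *\<^sub>R X y"
      by (simp add: E_def linear_scale[OF linear_tvec[OF c(1) y]] tvec_of_tangent[OF c(1) y X_tangent])
    then show ?thesis by (simp add: span_base span_scale)
  qed
  ultimately show ?thesis using W by blast
qed


section \<open>The linear Poincare flow in an adapted frame\<close>

definition frame_sign :: "'n \<Rightarrow> real" where "frame_sign i = (if i \<in> I then -1 else 1)"

lemma frame_sign_square: "frame_sign i * frame_sign i = 1"
  and frame_sign_nonzero: "frame_sign i \<noteq> 0"
  by (simp_all add: frame_sign_def)

text \<open>The pointwise part of \<open>adapted_frame_near\<close>, separated so that coordinates
  can be studied at one point.\<close>

definition adapted_basis :: "('n \<Rightarrow> 'm \<Rightarrow> ('m, 'n) tangent) \<Rightarrow> 'm \<Rightarrow> bool" where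
  "adapted_basis e y \<longleftrightarrow> inj (\<lambda>i. e i y) \<and> independent (range (\<lambda>i. e i y)) \<and>
    span (range (\<lambda>i. e i y)) = tangent_space A y \<and>
    (\<forall>\<alpha>. J y (frame_comb e y \<alpha>) = - (\<Sum>i\<in>I. (\<alpha> $ i)\<^sup>2) + (\<Sum>i\<in>-I. (\<alpha> $ i)\<^sup>2))"

lemma linear_frame_comb: "linear (frame_comb e y)"
  by (rule linearI) (simp_all add: frame_comb_def scaleR_left_distrib sum.distrib scaleR_sum_right)

lemma frame_comb_axis: "frame_comb e y (axis k 1) = e k y"
proof -
  have "frame_comb e y (axis k 1) = (\<Sum>i\<in>UNIV. if i = k then e k y else 0)"
    unfolding frame_comb_def by (intro sum.cong) (auto simp: axis_def)
  then show ?thesis by simp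
qed

context
  fixes e y assumes ab: "adapted_basis e y"
begin

lemma J_frame_comb: "J y (frame_comb e y \<alpha>) = (\<Sum>i\<in>UNIV. frame_sign i * (\<alpha> $ i)\<^sup>2)"
proof -
  have "(\<Sum>i\<in>UNIV. frame_sign i * (\<alpha> $ i)\<^sup>2) = (\<Sum>i\<in>I. frame_sign i * (\<alpha> $ i)\<^sup>2) + (\<Sum>i\<in>-I. frame_sign i * (\<alpha> $ i)\<^sup>2)"
    using sum.union_disjoint[of I "-I" "\<lambda>i. frame_sign i * (\<alpha> $ i)\<^sup>2"] by simp
  also have "\<dots> = - (\<Sum>i\<in>I. (\<alpha> $ i)\<^sup>2) + (\<Sum>i\<in>-I. (\<alpha> $ i)\<^sup>2)"
    by (simp add: frame_sign_def sum_negf)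
  finally show ?thesis using ab by (simp add: adapted_basis_def)
qed

lemma polar_frame_comb:
  "polar (J y) (frame_comb e y \<alpha>) (frame_comb e y \<beta>) = (\<Sum>i\<in>UNIV. frame_sign i * (\<alpha> $ i) * (\<beta> $ i))"
proof -
  have "polar (J y) (frame_comb e y \<alpha>) (frame_comb e y \<beta>) =
      (\<Sum>i\<in>UNIV. frame_sign i * ((\<alpha> + \<beta>) $ i)\<^sup>2 - frame_sign i * (\<alpha> $ i)\<^sup>2 - frame_sign i * (\<beta> $ i)\<^sup>2) / 2"
    unfolding polar_def linear_add[OF linear_frame_comb, symmetric] J_frame_comb
    by (simp add: sum_subtractf)
  also have "\<dots> = (\<Sum>i\<in>UNIV. frame_sign i * (\<alpha> $ i) * (\<beta> $ i))"
    unfolding sum_divide_distrib by (intro sum.cong) (auto simp: power2_eq_square algebra_simps)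
  finally show ?thesis .
qed

lemma polar_frame_comb_axis: "polar (J y) (frame_comb e y \<alpha>) (e k y) = frame_sign k * \<alpha> $ k"
proof -
  have "polar (J y) (frame_comb e y \<alpha>) (e k y) = (\<Sum>i\<in>UNIV. if i = k then frame_sign k * \<alpha> $ k else 0)"
    unfolding frame_comb_axis[symmetric, where e=e and y=y and k=k] polar_frame_comb
    by (intro sum.cong) (auto simp: axis_def)
  then show ?thesis by simp
qed

lemma inj_frame_comb: "frame_comb e y \<alpha> = frame_comb e y \<beta> \<longleftrightarrow> \<alpha> = \<beta>"
proof
  assume "frame_comb e y \<alpha> = frame_comb e y \<beta>"
  then have "frame_sign k * \<alpha> $ k = frame_sign k * \<beta> $ k" for k
    using polar_frame_comb_axis by metis
  then show "\<alpha> = \<beta>" by (simp add: vec_eq_iff frame_sign_nonzero)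
qed simp

lemma range_frame_comb: "range (frame_comb e y) = tangent_space A y"
proof -
  have inj: "inj (\<lambda>i. e i y)" and sp: "span (range (\<lambda>i. e i y)) = tangent_space A y"
    using ab by (auto simp: adapted_basis_def)
  show ?thesis
  proof
    show "range (frame_comb e y) \<subseteq> tangent_space A y"
      unfolding sp[symmetric] frame_comb_def by (intro image_subsetI span_sum span_scale span_base rangeI)
    show "tangent_space A y \<subseteq> range (frame_comb e y)"
    proof
      fix v assume "v \<in> tangent_space A y"
      then have "v \<in> range (\<lambda>u. \<Sum>w\<in>range (\<lambda>i. e i y). u w *\<^sub>R w)"
        unfolding sp[symmetric] by (simp add: span_finite)
      then obtain u where "v = (\<Sum>w\<in>range (\<lambda>i. e i y). u w *\<^sub>R w)" by blast
      also have "\<dots> = frame_comb e y (\<chi> i. u (e i y))"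
        by (simp add: frame_comb_def sum.reindex[OF inj])
      finally show "v \<in> range (frame_comb e y)" by blast
    qed
  qed
qed

lemma frame_comb_tangent: "frame_comb e y \<alpha> \<in> tangent_space A y"
  using range_frame_comb by auto

lemma frame_coords_comb: "frame_coords e y (frame_comb e y \<alpha>) = \<alpha>"
  unfolding frame_coords_def by (rule the_equality) (simp_all add: inj_frame_comb)

lemma frame_comb_coords: "v \<in> tangent_space A y \<Longrightarrow> frame_comb e y (frame_coords e y v) = v"
  using range_frame_comb frame_coords_comb by (metis rangeE)

text \<open>Coordinates are obtained by pairing with the frame, not by inverting it. This expresses
  the entries of the cocycle matrix through quantities whose derivatives in time are known.\<close>

lemma frame_coords_nth: "v \<in> tangent_space A y \<Longrightarrow> frame_coords e y v $ i = frame_sign i * polar (J y) v (e i y)"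
  using polar_frame_comb_axis[of "frame_coords e y v" i] frame_comb_coords
  by (simp add: frame_sign_square flip: mult.assoc)

text \<open>\<open>frame_coords\<close> is meaningful only on the tangent space; composed with a map
  into that space it becomes linear on a whole type, as \<open>matrix\<close> requires.\<close>

lemma linear_frame_coords_comp:
  assumes f: "linear f" and "\<And>v. f v \<in> tangent_space A y"
  shows "linear (\<lambda>v. frame_coords e y (f v))"
proof (rule linearI)
  show "frame_coords e y (f (u + v)) = frame_coords e y (f u) + frame_coords e y (f v)" for u v
    using frame_comb_coords[OF assms(2)] frame_coords_comb
    by (metis linear_add[OF f] linear_add[OF linear_frame_comb])
  show "frame_coords e y (f (r *\<^sub>R v)) = r *\<^sub>R frame_coords e y (f v)" for r v
    using frame_comb_coords[OF assms(2)] frame_coords_comb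
    by (metis linear_scale[OF f] linear_scale[OF linear_frame_comb])
qed

text \<open>For uniqueness, vanishing of the pairing with \<open>X y\<close> kills coordinate
  \<open>j\<close> of a candidate, while a difference along \<open>X y\<close> leaves every other
  coordinate unchanged.\<close>

lemma normal_proj_frame_comb:
  assumes ej: "e j y \<in> span {X y}"
  shows "normal_proj A X J y (frame_comb e y \<alpha>) = frame_comb e y (drop_coord j \<alpha>)"
proof -
  obtain r where r: "e j y = r *\<^sub>R X y" using ej by (auto simp: span_singleton)
  have "e j y \<noteq> 0"
    using inj_frame_comb[of "axis j 1" 0]
    by (simp add: frame_comb_axis linear_0[OF linear_frame_comb] axis_eq_0_iff)
  \<comment> \<open>Thus \<open>X y\<close> is non-zero as well and spans the same line as
    \<open>e j y\<close>.\<close>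
  then have r0: "r \<noteq> 0" using r by auto
  have X: "X y = inverse r *\<^sub>R e j y" using r r0 by simp
  have Xc: "X y = frame_comb e y (inverse r *\<^sub>R axis j 1)"
    by (simp add: X linear_scale[OF linear_frame_comb] frame_comb_axis)
  have pol: "polar (J y) (frame_comb e y \<beta>) (X y) = inverse r * (frame_sign j * \<beta> $ j)" for \<beta>
  proof -
    have "polar (J y) (frame_comb e y \<beta>) (X y) = (\<Sum>i\<in>UNIV. if i = j then inverse r * (frame_sign j * \<beta> $ j) else 0)"
      unfolding Xc polar_frame_comb by (intro sum.cong) (auto simp: axis_def)
    then show ?thesis by simp
  qed
  show ?thesis
    unfolding normal_proj_def
  proof (rule the_equality)
    have "\<alpha> - drop_coord j \<alpha> = (\<alpha> $ j * r) *\<^sub>R (inverse r *\<^sub>R axis j 1)"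
      using r0 by (auto simp: drop_coord_def vec_eq_iff axis_def)
    then have "frame_comb e y \<alpha> - frame_comb e y (drop_coord j \<alpha>) = (\<alpha> $ j * r) *\<^sub>R X y"
      unfolding Xc by (metis linear_diff[OF linear_frame_comb] linear_scale[OF linear_frame_comb])
    then have "frame_comb e y \<alpha> - frame_comb e y (drop_coord j \<alpha>) \<in> span {X y}"
      by (simp add: span_base span_scale)
    moreover have "polar (J y) (frame_comb e y (drop_coord j \<alpha>)) (X y) = 0"
      unfolding pol by (simp add: drop_coord_def)
    ultimately show "frame_comb e y (drop_coord j \<alpha>) \<in> normal_space A X J y \<and>
        frame_comb e y \<alpha> - frame_comb e y (drop_coord j \<alpha>) \<in> span {X y}"
      using frame_comb_tangent by (simp add: normal_space_def)
  next
    fix w assume w: "w \<in> normal_space A X J y \<and> frame_comb e y \<alpha> - w \<in> span {X y}"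
    then have "w \<in> range (frame_comb e y)" by (simp add: normal_space_def range_frame_comb)
    then obtain \<beta> where \<beta>: "w = frame_comb e y \<beta>" by blast
    have "inverse r * (frame_sign j * \<beta> $ j) = 0" using w pol[of \<beta>] by (simp add: normal_space_def \<beta>)
    then have "\<beta> $ j = 0" using r0 by (simp add: frame_sign_nonzero)
    obtain a where "frame_comb e y \<alpha> - w = a *\<^sub>R X y" using w by (auto simp: span_singleton)
    then have "frame_comb e y (\<alpha> - \<beta>) = frame_comb e y (a *\<^sub>R (inverse r *\<^sub>R axis j 1))"
      unfolding \<beta> Xc by (metis linear_diff[OF linear_frame_comb] linear_scale[OF linear_frame_comb])
    then have eq: "\<alpha> - \<beta> = a *\<^sub>R (inverse r *\<^sub>R axis j 1)" by (simp add: inj_frame_comb)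
    have "\<alpha> $ i - \<beta> $ i = 0" if "i \<noteq> j" for i
      using arg_cong[OF eq, of "\<lambda>v. v $ i"] that by (simp add: axis_def)
    with \<open>\<beta> $ j = 0\<close> have "\<beta> = drop_coord j \<alpha>" by (auto simp: drop_coord_def vec_eq_iff)
    then show "w = frame_comb e y (drop_coord j \<alpha>)" by (simp add: \<beta>)
  qed
qed

lemma Pi_mat_mult:
  assumes "e j y \<in> span {X y}"
  shows "Pi_mat A X J e y *v \<alpha> = drop_coord j \<alpha>"
  unfolding Pi_mat_def normal_proj_frame_comb[OF assms] frame_coords_comb
  using matrix_vector_mul(2)[OF linear_drop_coord, of j] by metis

end

text \<open>All times from 0 onwards belong to the set, so derivatives at 0 within it are
  unique.\<close>

lemma trivial_limit_forward: "x \<in> U \<Longrightarrow> at 0 within {t. Xt t x \<in> U} \<noteq> bot"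
proof -
  assume x: "x \<in> U"
  have "{0..} \<subseteq> {t. Xt t x \<in> U}"
  proof
    fix t :: real assume "t \<in> {0..}"
    then have "t = 0 \<or> 0 < t" by auto
    then show "t \<in> {t. Xt t x \<in> U}" using forward Xt_0[of x] x by auto
  qed
  moreover have "at 0 within {0::real..} \<noteq> bot" by (simp add: at_within_Ici_at_right)
  ultimately show ?thesis by (metis at_le bot.extremum_unique)
qed

lemma poincare_flow_derivative:
  assumes x: "x \<in> U" and frame: "adapted_frame_near A Xt J U I x e"
    and split: "open W2" "x \<in> W2" "\<And>y. y \<in> W2 \<inter> U \<Longrightarrow> e j y \<in> span {X y}"
  shows "adapted_basis e x"
    and "transpose (J_hat A X Xt DX J U I e x) = J_hat A X Xt DX J U I e x"
    and "((\<lambda>t. J (Xt t x) (poincare_flow A X Xt DX J t x (frame_comb e x \<alpha>)))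
      has_real_derivative \<alpha> \<bullet> (J_hat A X Xt DX J U I e x *v \<alpha>)) (at 0 within {t. Xt t x \<in> U})"
proof -
  obtain W1 where W1: "open W1" "x \<in> W1" "\<And>y. y \<in> W1 \<inter> U \<Longrightarrow> adapted_basis e y"
    and C1e: "\<And>i c. c \<in> A \<Longrightarrow> C1_on_orbits Xt (W1 \<inter> U \<inter> fst c) (\<lambda>y. e i y c)"
    using frame unfolding adapted_frame_near_def adapted_basis_def C1_on_orbits_def by blast
  show ab: "adapted_basis e x" using W1 x by blast
  obtain c where c: "c \<in> A" "x \<in> fst c" by (rule chart_at)
  define W where "W = W1 \<inter> W2 \<inter> fst c"
  define S where "S = W \<inter> U"
  let ?T = "{t. Xt t x \<in> U}"
  let ?C = "\<lambda>t. cocycle_mat Xt DX e t x"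
  have W: "open W" "x \<in> W" using W1 split c chart_open[OF c(1)] by (auto simp: W_def)
  have S: "adapted_basis e y" "e j y \<in> span {X y}" "y \<in> fst c" "y \<in> U" if "y \<in> S" for y
    using that W1 split by (auto simp: S_def W_def)
  have xS: "x \<in> S" using W x by (simp add: S_def)
  define N where "N = {t. Xt t x \<in> W}"
  have N: "open N" "0 \<in> N" using orbit_open[OF W(1)] W(2) by (auto simp: N_def Xt_0)
  have SN: "{t. Xt t x \<in> S} = ?T \<inter> N" by (auto simp: S_def N_def)
  \<comment> \<open>The orbit stays in the open set \<open>W\<close> for times near 0, so the times
    spent in \<open>S\<close> and in \<open>U\<close> define the same filter. This reconciles the
    local domain of the frame with the derivative in the definition of monotonicity.\<close>
  have at_eq: "at 0 within {t. Xt t x \<in> S} = at 0 within ?T"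
    by (rule at_within_nhd[of _ N]) (use N SN in auto)
  have zero: "0 \<in> {t. Xt t x \<in> S}" using xS by (simp add: Xt_0)
  have diff: "(\<lambda>t. f (Xt t x)) differentiable (at 0 within {t. Xt t x \<in> S})"
    if f: "C1_on_orbits Xt S f" for f :: "'m \<Rightarrow> 'b::real_normed_vector"
  proof -
    obtain f' where "\<And>t. Xt t x \<in> S \<Longrightarrow>
      ((\<lambda>s. f (Xt s x)) has_vector_derivative f' x t) (at t within {s. Xt s x \<in> S})"
      using C1_on_orbitsE[OF f] xS by metis
    then show ?thesis using zero by (auto intro: differentiableI_vector)
  qed
  have lin: "linear (\<lambda>\<alpha>. DX t x (frame_comb e x \<alpha>))" for t
  proof -
    have "linear (\<lambda>\<alpha>. frame_comb e x \<alpha> c)"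
      by (rule linearI) (simp_all add: linear_add[OF linear_frame_comb] linear_scale[OF linear_frame_comb] scaleR_fun_def)
    from linear_compose[OF this linear_DX[OF c, of t]] show ?thesis
      using tvec_of_tangent[OF c frame_comb_tangent[OF ab]] by (simp add: o_def)
  qed
  have DXt: "DX t x (frame_comb e x \<alpha>) \<in> tangent_space A (Xt t x)" for t \<alpha>
    by (intro DX_tangent frame_comb_tangent[OF ab])
  have Cv: "?C t *v \<alpha> = frame_coords e (Xt t x) (DX t x (frame_comb e x \<alpha>))" if "Xt t x \<in> S" for t \<alpha>
    unfolding cocycle_mat_def
    using matrix_vector_mul(2)[OF linear_frame_coords_comp[OF S(1)[OF that] lin DXt]] by metis
  have C0: "?C 0 *v \<alpha> = \<alpha>" for \<alpha>
    using Cv[of 0] xS DX_0[OF frame_comb_tangent[OF ab]] frame_coords_comb[OF ab] by (simp add: Xt_0)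
  have "(\<lambda>t. ?C t $ i $ k) differentiable (at 0 within {t. Xt t x \<in> S})" for i k
  proof -
    have "e k x \<in> tangent_space A x" using frame_comb_tangent[OF ab, of "axis k 1"] by (simp add: frame_comb_axis)
    then obtain D where "((\<lambda>t. DX t x (e k x) c) has_vector_derivative D) (at 0)"
      using DX_has_vector_derivative_0[OF c] by blast
    then have w: "(\<lambda>t. DX t x (e k x) c) differentiable (at 0 within {t. Xt t x \<in> S})"
      by (rule differentiableI_vector[OF has_vector_derivative_at_within])
    have nth: "(\<lambda>t. f t $ a) differentiable F" if "f differentiable F" for f :: "real \<Rightarrow> real^'n" and a F
      using that bounded_linear.has_derivative[OF bounded_linear_vec_nth] unfolding differentiable_def by blast
    have ei: "C1_on_orbits Xt S (\<lambda>y. e i y c)"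
      by (rule C1_on_orbits_subset[OF C1e[OF c(1)]]) (auto simp: S_def W_def)
    have B: "C1_on_orbits Xt S (\<lambda>y. chart_form c y (axis a 1) (axis b 1))" for a b
      by (rule C1_on_orbits_chart_form[OF c(1) _ C1_on_orbits_const C1_on_orbits_const]) (auto simp: S_def W_def)
    \<comment> \<open>The entry of the cocycle matrix as a pairing, expanded in the chart into
      products of three functions of \<open>t\<close>: coordinates of the transported vector,
      coordinates of the frame vector, and coefficients of the form. Each is differentiable at
      0.\<close>
    let ?g = "\<lambda>t. frame_sign i * (\<Sum>a\<in>UNIV. (DX t x (e k x) c $ a) *
        (\<Sum>b\<in>UNIV. (e i (Xt t x) c $ b) * chart_form c (Xt t x) (axis a 1) (axis b 1)))"
    have "?g differentiable (at 0 within {t. Xt t x \<in> S})"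
      by (intro differentiable_mult differentiable_const differentiable_sum ballI nth w diff[OF B] diff[OF ei]) simp_all
    then show ?thesis
    proof (rule differentiable_transform_within[OF _ zero_less_one zero])
      fix t assume "t \<in> {t. Xt t x \<in> S}"
      then have t: "Xt t x \<in> S" by simp
      have eT: "e i (Xt t x) \<in> tangent_space A (Xt t x)"
        using frame_comb_tangent[OF S(1)[OF t], of "axis i 1"] by (simp add: frame_comb_axis)
      have "?C t $ i $ k = (?C t *v axis k 1) $ i"
        by (simp add: matrix_vector_mult_basis column_def)
      also have "\<dots> = frame_sign i * polar (J (Xt t x)) (DX t x (e k x)) (e i (Xt t x))"
        using frame_coords_nth[OF S(1)[OF t] DXt[of t "axis k 1"], of i] by (simp add: Cv[OF t] frame_comb_axis)
      also have "\<dots> = frame_sign i * chart_form c (Xt t x) (DX t x (e k x) c) (e i (Xt t x) c)"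
        using tvec_of_tangent[OF c(1) S(3)[OF t]] DXt[of t "axis k 1"] eT
        by (simp add: chart_form_def frame_comb_axis)
      also have "\<dots> = ?g t"
        by (simp only: chart_form_expansion[OF c(1) S(3,4)[OF t], of "DX t x (e k x) c" "e i (Xt t x) c"])
      finally show "?g t = ?C t $ i $ k" by (rule sym)
    qed
  qed
  then have "(\<lambda>t. \<Sum>i\<in>UNIV. \<Sum>k\<in>UNIV. (?C t $ i $ k) *\<^sub>R axis i (axis k (1::real))) differentiable (at 0 within ?T)"
    unfolding at_eq by (intro differentiable_sum ballI differentiable_scaleR differentiable_const) simp_all
  moreover have C_sum: "(\<lambda>t. \<Sum>i\<in>UNIV. \<Sum>k\<in>UNIV. (?C t $ i $ k) *\<^sub>R axis i (axis k 1)) = ?C"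
    by (intro ext) (rule matrix_eq_sum_axis[symmetric])
  ultimately have "?C differentiable (at 0 within ?T)" unfolding C_sum by blast
  \<comment> \<open>Differentiability is what gives \<open>DX_mat\<close> its meaning, since
    \<open>vector_derivative\<close> selects a derivative only where one exists.\<close>
  then have C: "(?C has_vector_derivative DX_mat Xt DX U e x) (at 0 within ?T)"
    unfolding DX_mat_def by (simp add: vector_derivative_works)
  define D where "D = DX_mat Xt DX U e x"
  define P where "P = Pi_mat A X J e x"
  define K where "K = transpose P ** J_mat I ** P"
  have Jh: "J_hat A X Xt DX J U I e x = transpose D ** K + K ** D"
    by (simp add: J_hat_def D_def P_def K_def Let_def)
  have Ksym: "transpose K = K"
    by (simp add: K_def matrix_transpose_mul transpose_J_mat matrix_mul_assoc)
  show "transpose (J_hat A X Xt DX J U I e x) = J_hat A X Xt DX J U I e x"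
  proof -
    have "transpose (M + N) = transpose M + transpose N" for M N :: "real^'n^'n"
      by (simp add: transpose_def vec_eq_iff)
    then show ?thesis by (simp add: Jh matrix_transpose_mul Ksym add.commute)
  qed
  have Pv: "P *v \<alpha> = drop_coord j \<alpha>" for \<alpha>
    unfolding P_def by (rule Pi_mat_mult[OF ab S(2)[OF xS]])
  have Kform: "J y (frame_comb e y (drop_coord j \<alpha>)) = \<alpha> \<bullet> (K *v \<alpha>)" if "y \<in> S" for y \<alpha>
  proof -
    have "\<alpha> \<bullet> (K *v \<alpha>) = (P *v \<alpha>) \<bullet> (J_mat I *v (P *v \<alpha>))"
      by (simp add: K_def inner_vector_matrix_mult flip: matrix_vector_mul_assoc matrix_mul_assoc)
    also have "\<dots> = (\<Sum>i\<in>UNIV. frame_sign i * (drop_coord j \<alpha> $ i)\<^sup>2)"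
      unfolding Pv J_mat_mult inner_vec_def by (intro sum.cong) (auto simp: frame_sign_def power2_eq_square)
    finally show ?thesis using J_frame_comb[OF S(1)[OF that]] by simp
  qed
  have "((\<lambda>t. ?C t *v \<alpha>) has_vector_derivative D *v \<alpha>) (at 0 within ?T)"
  proof -
    have "linear (\<lambda>M :: real^'n^'n. M *v \<alpha>)"
      by (rule linearI) (simp_all add: matrix_vector_mult_add_rdistrib scaleR_matrix_vector_assoc)
    then show ?thesis
      using bounded_linear.has_vector_derivative[OF linear_conv_bounded_linear[THEN iffD1] C] by (simp add: D_def)
  qed
  moreover from this have "((\<lambda>t. K *v (?C t *v \<alpha>)) has_vector_derivative K *v (D *v \<alpha>)) (at 0 within ?T)"
    by (rule bounded_linear.has_vector_derivative[OF matrix_vector_mul_bounded_linear])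
  ultimately have "((\<lambda>t. (?C t *v \<alpha>) \<bullet> (K *v (?C t *v \<alpha>))) has_vector_derivative
      (?C 0 *v \<alpha>) \<bullet> (K *v (D *v \<alpha>)) + (D *v \<alpha>) \<bullet> (K *v (?C 0 *v \<alpha>))) (at 0 within ?T)"
    by (rule bounded_bilinear.has_vector_derivative[OF bounded_bilinear_inner])
  \<comment> \<open>As \<open>?C 0\<close> is the identity, the first term of the product rule is
    the form of \<open>K ** D\<close>, and the second, with \<open>D\<close> moved across the inner
    product, that of \<open>transpose D ** K\<close>.\<close>
  also have "(?C 0 *v \<alpha>) \<bullet> (K *v (D *v \<alpha>)) + (D *v \<alpha>) \<bullet> (K *v (?C 0 *v \<alpha>)) =
      \<alpha> \<bullet> (J_hat A X Xt DX J U I e x *v \<alpha>)"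
    by (simp add: C0 Jh matrix_vector_mult_add_rdistrib inner_add_right inner_vector_matrix_mult
        flip: matrix_vector_mul_assoc)
  finally have "((\<lambda>t. (?C t *v \<alpha>) \<bullet> (K *v (?C t *v \<alpha>))) has_vector_derivative
      \<alpha> \<bullet> (J_hat A X Xt DX J U I e x *v \<alpha>)) (at 0 within {t. Xt t x \<in> S})"
    unfolding at_eq .
  then have "((\<lambda>t. J (Xt t x) (poincare_flow A X Xt DX J t x (frame_comb e x \<alpha>))) has_vector_derivative
      \<alpha> \<bullet> (J_hat A X Xt DX J U I e x *v \<alpha>)) (at 0 within {t. Xt t x \<in> S})"
  proof (rule has_vector_derivative_transform[OF zero, rotated])
    fix t assume "t \<in> {t. Xt t x \<in> S}"
    then have t: "Xt t x \<in> S" by simp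
    have "DX t x (frame_comb e x \<alpha>) = frame_comb e (Xt t x) (?C t *v \<alpha>)"
      unfolding Cv[OF t] by (rule frame_comb_coords[OF S(1)[OF t] DXt, symmetric])
    then show "J (Xt t x) (poincare_flow A X Xt DX J t x (frame_comb e x \<alpha>)) =
        (?C t *v \<alpha>) \<bullet> (K *v (?C t *v \<alpha>))"
      by (simp add: poincare_flow_def normal_proj_frame_comb[OF S(1,2)[OF t]] Kform[OF t])
  qed
  then show "((\<lambda>t. J (Xt t x) (poincare_flow A X Xt DX J t x (frame_comb e x \<alpha>))) has_real_derivative
      \<alpha> \<bullet> (J_hat A X Xt DX J U I e x *v \<alpha>)) (at 0 within ?T)"
    by (simp add: at_eq has_real_derivative_iff_has_vector_derivative)
qed

text \<open>The predicate \<open>P\<close> stands for either sign condition, so one argument serves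
  monotonicity and strict monotonicity. From left to right, uniqueness of the derivative identifies
  the given \<open>D\<close> with the value of the form.\<close>

lemma poincare_flow_derivative_sign:
  assumes x: "x \<in> U" and frame: "adapted_frame_near A Xt J U I x e"
    and split: "open W" "x \<in> W" "\<And>y. y \<in> W \<inter> U \<Longrightarrow> e j y \<in> span {X y}"
  shows "(\<forall>v\<in>tangent_space A x - {0}. \<exists>D. P D \<and>
      ((\<lambda>t. J (Xt t x) (poincare_flow A X Xt DX J t x v)) has_real_derivative D) (at 0 within {t. Xt t x \<in> U})) \<longleftrightarrow>
    (\<forall>\<alpha>. \<alpha> \<noteq> 0 \<longrightarrow> P (\<alpha> \<bullet> (J_hat A X Xt DX J U I e x *v \<alpha>)))"
proof -
  let ?d = "\<lambda>v D. ((\<lambda>t. J (Xt t x) (poincare_flow A X Xt DX J t x v)) has_real_derivative D)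
    (at 0 within {t. Xt t x \<in> U})"
  note d = poincare_flow_derivative[OF assms]
  have "tangent_space A x - {0} = frame_comb e x ` (UNIV - {0})"
    using range_frame_comb[OF d(1)] inj_frame_comb[OF d(1)] linear_0[OF linear_frame_comb, of e x]
    by (auto simp: image_iff) (metis rangeE)+
  moreover have "(\<exists>D. P D \<and> ?d (frame_comb e x \<alpha>) D) \<longleftrightarrow> P (\<alpha> \<bullet> (J_hat A X Xt DX J U I e x *v \<alpha>))" for \<alpha>
  proof -
    have "D = \<alpha> \<bullet> (J_hat A X Xt DX J U I e x *v \<alpha>)" if "?d (frame_comb e x \<alpha>) D" for D
      using vector_derivative_unique_within[OF trivial_limit_forward[OF x]] that d(3)[of \<alpha>]
      unfolding has_real_derivative_iff_has_vector_derivative by blast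
    then show ?thesis using d(3)[of \<alpha>] by blast
  qed
  ultimately show ?thesis by auto
qed

end

text \<open>The equivalences hold for every choice of frames that respect the splitting; the
  existence clause ensures that this is not vacuous.\<close>

theorem proposition1p4:
  fixes A :: "('m::t2_space, 'n::finite) chart set"
    and g :: "'m \<Rightarrow> ('m, 'n) tangent \<Rightarrow> ('m, 'n) tangent \<Rightarrow> real"
    and X :: "'m \<Rightarrow> ('m, 'n) tangent"
    and Xt :: "real \<Rightarrow> 'm \<Rightarrow> 'm"
    and DX :: "real \<Rightarrow> 'm \<Rightarrow> ('m, 'n) tangent \<Rightarrow> ('m, 'n) tangent"
    and U :: "'m set"
    and J :: "'m \<Rightarrow> ('m, 'n) tangent \<Rightarrow> real"
    and q :: nat and I :: "'n set"
  assumes "CARD('n) \<ge> 3"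
    and "compact (UNIV :: 'm set)" and "connected (UNIV :: 'm set)"
    and "smooth_atlas A" and "riemannian_metric A g"
    and "C1_vector_field A X" and "flow_of A X Xt" and "derivative_cocycle A Xt DX"
    and "\<forall>t>0. Xt t ` U \<subseteq> U"
    and "0 < q" and "q < CARD('n)" and "card I = q"
    and "nondegenerate_field A Xt U J q"
    and "\<forall>x\<in>U. J x (X x) \<ge> 0"
    and "\<forall>x\<in>U. X x \<noteq> 0 \<longrightarrow> nondegenerate_on (span {X x}) (J x)"
  shows "(\<exists>E. adapted_frames A X Xt J U I E \<and> respects_splitting X U E) \<and>
    (\<forall>E. adapted_frames A X Xt J U I E \<and> respects_splitting X U E \<longrightarrow>
       (poincare_monotone A X Xt DX J U \<longleftrightarrow>
          (\<forall>x\<in>U. X x \<noteq> 0 \<longrightarrow> nonneg_selfadjoint (J_hat A X Xt DX J U I (E x) x))) \<and>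
       (poincare_strictly_monotone A X Xt DX J U \<longleftrightarrow>
          (\<forall>x\<in>U. X x \<noteq> 0 \<longrightarrow> pos_selfadjoint (J_hat A X Xt DX J U I (E x) x))))"
proof (intro conjI allI impI)
  interpret flow_setting A X Xt DX U J q I
    by unfold_locales (fact assms)+
  have "I \<noteq> UNIV" using assms(11,12) by auto
  \<comment> \<open>Since \<open>q < CARD('n)\<close>, some index carries a positive sign; it is
    reserved for the flow direction in the frames at all points.\<close>
  then obtain j where j: "j \<notin> I" by blast
  have "\<forall>p. \<exists>e. p \<in> U \<and> X p \<noteq> 0 \<longrightarrow> adapted_frame_near A Xt J U I p e \<and>
      (\<exists>W. open W \<and> p \<in> W \<and> (\<forall>y\<in>W \<inter> U. e j y \<in> span {X y}))"
  proof
    fix p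
    show "\<exists>e. p \<in> U \<and> X p \<noteq> 0 \<longrightarrow> adapted_frame_near A Xt J U I p e \<and>
      (\<exists>W. open W \<and> p \<in> W \<and> (\<forall>y\<in>W \<inter> U. e j y \<in> span {X y}))"
    proof (cases "p \<in> U \<and> X p \<noteq> 0")
      case True
      then show ?thesis using adapted_frame_exists[of p, OF _ _ _ _ assms(12) j] assms(14,15) by simp
    qed blast
  qed
  then obtain E where E: "\<And>p. p \<in> U \<Longrightarrow> X p \<noteq> 0 \<Longrightarrow> adapted_frame_near A Xt J U I p (E p) \<and>
      (\<exists>W. open W \<and> p \<in> W \<and> (\<forall>y\<in>W \<inter> U. E p j y \<in> span {X y}))"
    by metis
  show "\<exists>E. adapted_frames A X Xt J U I E \<and> respects_splitting X U E"
  proof (intro exI conjI)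
    show "adapted_frames A X Xt J U I E"
      using E by (simp add: adapted_frames_def)
    show "respects_splitting X U E"
      unfolding respects_splitting_def
    proof (intro ballI impI)
      fix p assume "p \<in> U" "X p \<noteq> 0"
      then show "\<exists>W j. open W \<and> p \<in> W \<and> (\<forall>y\<in>W \<inter> U. E p j y \<in> span {X y})"
        using E[of p] by blast
    qed
  qed
next
  interpret flow_setting A X Xt DX U J q I
    by unfold_locales (fact assms)+
  fix E assume E: "adapted_frames A X Xt J U I E \<and> respects_splitting X U E"
  let ?d = "\<lambda>x v D. ((\<lambda>t. J (Xt t x) (poincare_flow A X Xt DX J t x v)) has_real_derivative D)
    (at 0 within {t. Xt t x \<in> U})"
  let ?M = "\<lambda>x. J_hat A X Xt DX J U I (E x) x"
  have *: "transpose (?M x) = ?M x"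
    "(\<forall>v\<in>tangent_space A x - {0}. \<exists>D. P D \<and> ?d x v D) \<longleftrightarrow> (\<forall>\<alpha>. \<alpha> \<noteq> 0 \<longrightarrow> P (\<alpha> \<bullet> (?M x *v \<alpha>)))"
    if x: "x \<in> U" "X x \<noteq> 0" for x P
  proof -
    have frame: "adapted_frame_near A Xt J U I x (E x)" using E x by (simp add: adapted_frames_def)
    obtain W j where W: "open W" "x \<in> W" "\<And>y. y \<in> W \<inter> U \<Longrightarrow> E x j y \<in> span {X y}"
      using E x unfolding respects_splitting_def by blast
    show "transpose (?M x) = ?M x" by (rule poincare_flow_derivative(2)[OF x(1) frame W])
    show "(\<forall>v\<in>tangent_space A x - {0}. \<exists>D. P D \<and> ?d x v D) \<longleftrightarrow>
        (\<forall>\<alpha>. \<alpha> \<noteq> 0 \<longrightarrow> P (\<alpha> \<bullet> (?M x *v \<alpha>)))"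
      by (rule poincare_flow_derivative_sign[OF x(1) frame W])
  qed
  have "(\<forall>v\<in>tangent_space A x - {0}. \<exists>D\<ge>0. ?d x v D) \<longleftrightarrow> nonneg_selfadjoint (?M x)"
    if "x \<in> U" "X x \<noteq> 0" for x
    unfolding nonneg_selfadjoint_iff *(2)[OF that, of "\<lambda>D. 0 \<le> D"] by (simp add: *(1)[OF that])
  then show "poincare_monotone A X Xt DX J U \<longleftrightarrow> (\<forall>x\<in>U. X x \<noteq> 0 \<longrightarrow> nonneg_selfadjoint (?M x))"
    unfolding poincare_monotone_def by blast
  have "(\<forall>v\<in>tangent_space A x - {0}. \<exists>D>0. ?d x v D) \<longleftrightarrow> pos_selfadjoint (?M x)"
    if "x \<in> U" "X x \<noteq> 0" for x
    unfolding pos_selfadjoint_iff *(2)[OF that, of "\<lambda>D. 0 < D"] by (simp add: *(1)[OF that])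
  then show "poincare_strictly_monotone A X Xt DX J U \<longleftrightarrow> (\<forall>x\<in>U. X x \<noteq> 0 \<longrightarrow> pos_selfadjoint (?M x))"
    unfolding poincare_strictly_monotone_def by blast
qed

end
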